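(* For $r=2$, the matrix reachability problem and the vector reachability problem over the max-plus semiring $\mathbb{Z}_{\max}=(\mathbb{Z}\cup\{-\infty\},\max,+)$ are undecidable. That is, each of the following two problems is undecidable: (i) given $n\ge1$ and matrices $A_1,A_2,M\in\mathbb{Z}_{\max}^{n\times n}$, is there a finite sequence $i_1,\dots,i_k\in\{1,2\}$, $k\ge1$, such that $A_{i_1}\cdots A_{i_k}=M$? (ii) given $n\ge1$, matrices $A_1,A_2\in\mathbb{Z}_{\max}^{n\times n}$ and row vectors $\alpha,\eta\in\mathbb{Z}_{\max}^{1\times n}$, is there a finite sequence $i_1,\dots,i_k\in\{1,2\}$, $k\ge1$, such that $\alpha A_{i_1}\cdots A_{i_k}=\eta$?
   Context: In the max-plus semiring $\mathbb{Z}_{\max}$ the addition is $\max$ (with zero element $-\infty$) and the multiplication is the usual $+$ (with unit element $0$, and $-\infty$ absorbing). Matrix products are taken in this semiring: $(AB)_{ij}=\max_k(A_{ik}+B_{kj})$. *)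

theory Defs
  imports "HOL-Library.Nat_Bijection" "Jordan_Normal_Form.Matrix"
begin

section \<open>Partial recursive functions and decidability\<close>

datatype recf =
    Zero
  | Succ
  | Proj nat
  | Comp recf "recf list"
  | PrimRec recf recf
  | Mu recf

text \<open>Terms carry no arity: \<^term>\<open>Zero\<close> and \<^term>\<open>Proj i\<close> apply to argument lists of any
  (for projections: sufficient) length. The recursion and minimisation variable is the first
  argument. A term denotes the partial function whose graph is the following relation;
  minimisation requires all smaller values to be defined and positive.\<close>

inductive computes :: "recf \<Rightarrow> nat list \<Rightarrow> nat \<Rightarrow> bool" where
  zero: "computes Zero xs 0"
| succ: "computes Succ [x] (Suc x)"
| proj: "i < length xs \<Longrightarrow> computes (Proj i) xs (xs ! i)"
| comp: "list_all2 (\<lambda>g y. computes g xs y) gs ys \<Longrightarrow> computes f ys z \<Longrightarrow>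
    computes (Comp f gs) xs z"
| prim_0: "computes f xs y \<Longrightarrow> computes (PrimRec f g) (0 # xs) y"
| prim_Suc: "computes (PrimRec f g) (n # xs) y \<Longrightarrow> computes g (n # y # xs) z \<Longrightarrow>
    computes (PrimRec f g) (Suc n # xs) z"
| mu: "computes f (n # xs) 0 \<Longrightarrow> (\<forall>m<n. \<exists>y. computes f (m # xs) y \<and> 0 < y) \<Longrightarrow>
    computes (Mu f) xs n"

inductive_cases computes_elims:
  "computes Zero xs z" "computes Succ xs z" "computes (Proj i) xs z"
  "computes (Comp f gs) xs z" "computes (PrimRec f g) (0 # xs) z"
  "computes (PrimRec f g) (Suc n # xs) z" "computes (Mu f) xs z"

lemma computes_deterministic:
  "computes f xs y \<Longrightarrow> computes f xs z \<Longrightarrow> y = z"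
proof (induction arbitrary: z rule: computes.induct)
  case (comp xs gs ys f w)
  from comp.prems obtain ys' where
    ys': "list_all2 (\<lambda>g y. computes g xs y) gs ys'" "computes f ys' z"
    by (blast elim: computes_elims)
  have "ys = ys'"
    using comp.IH(1) ys'(1)
    by (auto simp: list_all2_conv_all_nth intro!: nth_equalityI)
  with comp.IH ys'(2) show ?case by blast
next
  case (prim_Suc f g n xs y w)
  from prim_Suc.prems obtain y' where
    "computes (PrimRec f g) (n # xs) y'" "computes g (n # y' # xs) z"
    by (blast elim: computes_elims)
  with prim_Suc.IH show ?case by blast
next
  case (mu f n xs)
  from mu.prems have z: "computes f (z # xs) 0" "\<forall>m<z. \<exists>y. computes f (m # xs) y \<and> 0 < y"
    by (auto elim!: computes_elims(7))
  show ?case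
  proof (cases n z rule: linorder_cases)
    case less
    then show ?thesis using mu.IH(1) z(2) by fastforce
  next
    case greater
    then show ?thesis using mu.IH(2) z(1) by fastforce
  qed
qed (blast elim: computes_elims)+

text \<open>A decision problem is a set \<^term>\<open>I\<close> of instances with a property \<^term>\<open>P\<close> of them. The
  algorithm must halt with the correct answer on the code of each instance; nothing is
  required on numbers that are not codes of instances.\<close>

definition decidable :: "('a \<Rightarrow> nat) \<Rightarrow> 'a set \<Rightarrow> ('a \<Rightarrow> bool) \<Rightarrow> bool" where
  "decidable code I P \<longleftrightarrow> (\<exists>f. \<forall>x\<in>I. computes f [code x] (if P x then 1 else 0))"


section \<open>The max-plus semiring\<close>

datatype zmax = NegInf | Fin int

instantiation zmax :: comm_semiring_1
begin

definition zero_zmax :: zmax where "0 = NegInf"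

definition one_zmax :: zmax where "1 = Fin 0"

fun plus_zmax :: "zmax \<Rightarrow> zmax \<Rightarrow> zmax" where
  "NegInf + y = y"
| "x + NegInf = x"
| "Fin a + Fin b = Fin (max a b)"

fun times_zmax :: "zmax \<Rightarrow> zmax \<Rightarrow> zmax" where
  "NegInf * y = NegInf"
| "x * NegInf = NegInf"
| "Fin a * Fin b = Fin (a + b)"

instance
proof
  fix a b c :: zmax
  show "a * b * c = a * (b * c)" by (cases a; cases b; cases c) auto
  show "a * b = b * a" by (cases a; cases b) auto
  show "1 * a = a" by (cases a) (auto simp: one_zmax_def)
  show "a + b + c = a + (b + c)" by (cases a; cases b; cases c) auto
  show "a + b = b + a" by (cases a; cases b) auto
  show "0 + a = a" by (auto simp: zero_zmax_def)
  show "0 * a = 0" by (auto simp: zero_zmax_def)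
  show "a * 0 = 0" by (cases a) (auto simp: zero_zmax_def)
  show "(a + b) * c = a * c + b * c" by (cases a; cases b; cases c) auto
  show "(0 :: zmax) \<noteq> 1" by (simp add: zero_zmax_def one_zmax_def)
qed

end

text \<open>Semiring notation: \<^term>\<open>(+)\<close> on \<^typ>\<open>zmax\<close> is the maximum and \<^term>\<open>(*)\<close> is integer addition,
  so that \<^term>\<open>0 :: zmax\<close> is minus infinity and \<^term>\<open>1 :: zmax\<close> is the integer zero. The
  generic matrix product over \<^typ>\<open>zmax\<close> is then the max-plus product.\<close>


section \<open>Reachability problems\<close>

text \<open>Generators are indexed from 0. The words \<^term>\<open>w\<close> are nonempty, so the identity matrix
  only serves as the neutral start of the product.\<close>

type_synonym matrix_instance = "nat \<times> zmax mat list \<times> zmax mat"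

definition matrix_instances :: "nat \<Rightarrow> matrix_instance set" where
  "matrix_instances r = {(n, As, M). 1 \<le> n \<and> length As = r \<and>
     set As \<subseteq> carrier_mat n n \<and> M \<in> carrier_mat n n}"

fun matrix_reachable :: "matrix_instance \<Rightarrow> bool" where
  "matrix_reachable (n, As, M) \<longleftrightarrow>
     (\<exists>w. w \<noteq> [] \<and> set w \<subseteq> {..<length As} \<and> foldr (\<lambda>i B. As ! i * B) w (1\<^sub>m n) = M)"

type_synonym vector_instance = "nat \<times> zmax mat list \<times> zmax mat \<times> zmax mat"

definition vector_instances :: "nat \<Rightarrow> vector_instance set" where
  "vector_instances r = {(n, As, \<alpha>, \<eta>). 1 \<le> n \<and> length As = r \<and>
     set As \<subseteq> carrier_mat n n \<and> \<alpha> \<in> carrier_mat 1 n \<and> \<eta> \<in> carrier_mat 1 n}"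

fun vector_reachable :: "vector_instance \<Rightarrow> bool" where
  "vector_reachable (n, As, \<alpha>, \<eta>) \<longleftrightarrow>
     (\<exists>w. w \<noteq> [] \<and> set w \<subseteq> {..<length As} \<and> foldl (\<lambda>v i. v * As ! i) \<alpha> w = \<eta>)"


section \<open>Encoding of instances\<close>

fun zmax_code :: "zmax \<Rightarrow> nat" where
  "zmax_code NegInf = 0"
| "zmax_code (Fin a) = Suc (int_encode a)"

definition mat_code :: "zmax mat \<Rightarrow> nat" where
  "mat_code A = list_encode (map (\<lambda>row. list_encode (map zmax_code row)) (mat_to_list A))"

fun matrix_code :: "matrix_instance \<Rightarrow> nat" where
  "matrix_code (n, As, M) = list_encode [n, list_encode (map mat_code As), mat_code M]"

fun vector_code :: "vector_instance \<Rightarrow> nat" where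
  "vector_code (n, As, \<alpha>, \<eta>) =
     list_encode [n, list_encode (map mat_code As), mat_code \<alpha>, mat_code \<eta>]"

lemma inj_zmax_code: "inj zmax_code"
proof (rule injI)
  fix x y assume "zmax_code x = zmax_code y"
  then show "x = y" by (cases x; cases y) (auto simp: inj_eq[OF inj_int_encode])
qed

lemma mat_code_inj: "inj_on mat_code (carrier_mat m n)"
proof (rule inj_onI)
  fix A B :: "zmax mat"
  assume AB: "A \<in> carrier_mat m n" "B \<in> carrier_mat m n" "mat_code A = mat_code B"
  have "inj (\<lambda>row. list_encode (map zmax_code row))"
    by (intro injI) (simp add: list_encode_eq inj_map_eq_map[OF inj_zmax_code])
  then have "mat_to_list A = mat_to_list B"
    using AB(3) by (simp add: mat_code_def list_encode_eq inj_map_eq_map)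
  then have "A $$ (i, j) = B $$ (i, j)" if "i < m" "j < n" for i j
    using AB(1,2) that unfolding mat_to_list_def
    by (auto simp: list_eq_iff_nth_eq)
  with AB(1,2) show "A = B" by auto
qed

lemma matrix_code_inj: "inj_on matrix_code (matrix_instances r)"
proof (rule inj_onI)
  fix x y assume *: "x \<in> matrix_instances r" "y \<in> matrix_instances r" "matrix_code x = matrix_code y"
  obtain n As M n' As' M' where xy: "x = (n, As, M)" "y = (n', As', M')" by (cases x; cases y)
  from *(3) have eq: "n' = n" "map mat_code As = map mat_code As'" "mat_code M = mat_code M'"
    by (simp_all only: xy matrix_code.simps list_encode_eq list.inject)
  with * have car: "set As \<union> set As' \<subseteq> carrier_mat n n" "M \<in> carrier_mat n n" "M' \<in> carrier_mat n n"
    by (auto simp: xy matrix_instances_def)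
  have "inj_on mat_code (set As \<union> set As')" by (rule inj_on_subset[OF mat_code_inj car(1)])
  then have "As = As'" using eq(2) by (simp add: inj_on_map_eq_map)
  moreover have "M = M'" using inj_onD[OF mat_code_inj eq(3)] car by blast
  ultimately show "x = y" using eq(1) xy by simp
qed

lemma vector_code_inj: "inj_on vector_code (vector_instances r)"
proof (rule inj_onI)
  fix x y assume *: "x \<in> vector_instances r" "y \<in> vector_instances r" "vector_code x = vector_code y"
  obtain n As a b n' As' a' b' where xy: "x = (n, As, a, b)" "y = (n', As', a', b')"
    by (cases x; cases y)
  from *(3) have eq: "n' = n" "map mat_code As = map mat_code As'"
      "mat_code a = mat_code a'" "mat_code b = mat_code b'"
    by (simp_all only: xy vector_code.simps list_encode_eq list.inject)
  with * have car: "set As \<union> set As' \<subseteq> carrier_mat n n"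
      "a \<in> carrier_mat 1 n" "a' \<in> carrier_mat 1 n" "b \<in> carrier_mat 1 n" "b' \<in> carrier_mat 1 n"
    by (auto simp: xy vector_instances_def)
  have "inj_on mat_code (set As \<union> set As')" by (rule inj_on_subset[OF mat_code_inj car(1)])
  then have "As = As'" using eq(2) by (simp add: inj_on_map_eq_map)
  moreover have "a = a'" using inj_onD[OF mat_code_inj eq(3)] car by blast
  moreover have "b = b'" using inj_onD[OF mat_code_inj eq(4)] car by blast
  ultimately show "x = y" using eq(1) xy by simp
qed

end

theory Submission
  imports Defs
begin

text \<open>The proof is a diagonal argument through a simulation of arbitrary partial recursive functions.
For every \<^typ>\<open>recf\<close> term \<^term>\<open>g\<close> and arity \<^term>\<open>k\<close> there are two max-plus matrices and a target, of
which only the target depends on the arguments \<^term>\<open>xs\<close> of \<^term>\<open>g\<close>, such that the target can be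
reached exactly when \<^term>\<open>g\<close> is defined at \<^term>\<open>xs\<close> (\<open>matrix_instances_for\<close>,
\<open>vector_instances_for\<close>). The arguments occur in one row of the target only, as entries
\<open>x\<close> and \<open>-x\<close>, so the code of the instance is an elementary function of \<^term>\<open>xs\<close> and of the codes of the
parts that do not depend on \<^term>\<open>xs\<close>. Given a decision procedure \<^term>\<open>D\<close>, let \<^term>\<open>g\<close> take the codes of
these parts as its arguments, assemble the code of the instance in which the target itself
carries these same arguments, apply \<^term>\<open>D\<close>, and halt iff the answer is no. On the parts
of its own instances \<^term>\<open>g\<close> halts iff the instance is not reachable, hence iff \<^term>\<open>g\<close> does not halt.

The simulation has three stages.

\<^item> A recursive function is turned into a structured program over counters with sequencing
  and nondeterministic iteration (\<open>implementable\<close>). Its semantics is a relation that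
  describes all runs exactly, so runs that guess badly just get stuck. Prefixed by a guess of
  its own input, such a program leads from the empty store exactly to the stores that hold
  an argument list at which the function is defined (\<open>halting_program\<close>).

\<^item> The control states of a program form a finite graph, and a word over its edges is a
  possible computation. A row vector tracks a configuration: the current control state is marked
  by \<open>0\<close> among entries \<open>-\<infinity>\<close>, and a counter with value \<open>c\<close> is kept as the two entries \<open>c\<close>
  and \<open>-c\<close>. An edge moves the mark and adds a constant to these entries. The conditions on
  counters cannot be enforced, but violations can be recorded: a zero test contributes \<open>c\<close>, and a
  decrement \<open>1 - c\<close>, to the maximum held in an error entry, which stays at \<open>0\<close> as long
  as all conditions are met and can never return to it. Since a vector must be hit exactly,
  reaching the vector of a final configuration means that some computation leads there
  (\<open>reach_sound\<close>, \<open>reach_complete\<close>). This idea of verifying a guessed computation by a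
  maximum of errors underlies the known undecidability proofs for max-plus automata.

\<^item> An alphabet of \<open>r\<close> matrices is replaced by two by adding a phase \<open>j < r\<close> to every index: one
  letter advances the phase, the other applies the matrix numbered by the phase and resets the phase
  (\<open>two_letters_sound\<close>, \<open>two_letters_complete\<close>). The last of the \<open>r\<close> matrices creates the
  initial configuration out of one special index and sends every other row to \<open>-\<infinity>\<close>, so that
  a product beginning with its code word has a single nonzero row. This makes vector
  reachability from the unit vector of the special index and matrix reachability coincide.\<close>

section \<open>Nondeterministic counter programs\<close>

type_synonym store = "nat \<Rightarrow> nat"

datatype instr = Skip | Inc nat | Dec nat | Test nat

datatype prog = Do instr | Seq prog prog | Star prog

text \<open>\<^const>\<open>Dec\<close> and \<^const>\<open>Test\<close> are blocking: a run whose guard fails has no continuation. Together with the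
unconstrained iteration \<open>Star\<close> this expresses all loops and conditionals, since a wrong
number of iterations is caught by a later guard.\<close>

fun exec :: "instr \<Rightarrow> (store \<times> store) set" where
  "exec Skip = Id"
| "exec (Inc c) = {(s, t). t = s(c := Suc (s c))}"
| "exec (Dec c) = {(s, t). 0 < s c \<and> t = s(c := s c - 1)}"
| "exec (Test c) = {(s, t). s c = 0 \<and> t = s}"

fun rel :: "prog \<Rightarrow> (store \<times> store) set" where
  "rel (Do i) = exec i"
| "rel (Seq P Q) = rel P O rel Q"
| "rel (Star P) = (rel P)\<^sup>*"

lemma rel_Seq_iff: "(s, t) \<in> rel (Seq P Q) \<longleftrightarrow> (\<exists>u. (s, u) \<in> rel P \<and> (u, t) \<in> rel Q)"
  by auto

fun increments :: "nat list \<Rightarrow> prog" where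
  "increments [] = Do Skip"
| "increments (c # cs) = Seq (Do (Inc c)) (increments cs)"

lemma rel_increments:
  "distinct cs \<Longrightarrow> (s, t) \<in> rel (increments cs) \<longleftrightarrow> t = (\<lambda>r. if r \<in> set cs then Suc (s r) else s r)"
proof (induction cs arbitrary: s)
  case (Cons c cs)
  then have "(s, t) \<in> rel (increments (c # cs)) \<longleftrightarrow>
      t = (\<lambda>r. if r \<in> set cs then Suc ((s(c := Suc (s c))) r) else (s(c := Suc (s c))) r)"
    by (simp add: relcomp_unfold)
  also have "\<dots> \<longleftrightarrow> t = (\<lambda>r. if r \<in> set (c # cs) then Suc (s r) else s r)"
    using Cons.prems by (intro arg_cong[where f = "(=) t"]) auto
  finally show ?case .
qed auto

text \<open>The loop \<open>while a > 0\<close>: the iteration may stop early, but then the final test blocks. Pouring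
into no counter at all resets \<open>a\<close>.\<close>

definition pour :: "nat \<Rightarrow> nat list \<Rightarrow> prog" where
  "pour a cs = Seq (Star (Seq (Do (Dec a)) (increments cs))) (Do (Test a))"

lemma rel_pour:
  assumes "distinct cs" "a \<notin> set cs"
  shows "(s, t) \<in> rel (pour a cs) \<longleftrightarrow>
    t = (\<lambda>r. if r = a then 0 else if r \<in> set cs then s r + s a else s r)"
proof -
  define body where "body = Seq (Do (Dec a)) (increments cs)"
  define poured :: "nat \<Rightarrow> store" where
    "poured k = (\<lambda>r. if r = a then s a - k else if r \<in> set cs then s r + k else s r)" for k
  have body: "(u, v) \<in> rel body \<longleftrightarrow> 0 < u a \<and>
      v = (\<lambda>r. if r = a then u a - 1 else if r \<in> set cs then Suc (u r) else u r)" for u v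
  proof -
    have "(u, v) \<in> rel body \<longleftrightarrow> 0 < u a \<and>
        v = (\<lambda>r. if r \<in> set cs then Suc ((u(a := u a - 1)) r) else (u(a := u a - 1)) r)"
      by (simp add: body_def relcomp_unfold rel_increments[OF assms(1)] del: One_nat_def)
    also have "(\<lambda>r. if r \<in> set cs then Suc ((u(a := u a - 1)) r) else (u(a := u a - 1)) r) =
        (\<lambda>r. if r = a then u a - 1 else if r \<in> set cs then Suc (u r) else u r)"
      using assms(2) by auto
    finally show ?thesis .
  qed
  have "\<exists>k\<le>s a. t = poured k" if "(s, t) \<in> (rel body)\<^sup>*" for t
    using that
  proof induction
    case base
    show ?case by (intro exI[of _ 0]) (simp add: poured_def fun_eq_iff)
  next
    case (step u v)
    then obtain k where k: "k \<le> s a" "u = poured k" by blast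
    from step(2) have "Suc k \<le> s a" "v = poured (Suc k)"
      unfolding body k(2) by (auto simp: poured_def fun_eq_iff)
    then show ?case by blast
  qed
  moreover have "k \<le> s a \<Longrightarrow> (s, poured k) \<in> (rel body)\<^sup>*" for k
  proof (induction k)
    case 0
    have "poured 0 = s" by (simp add: poured_def fun_eq_iff)
    then show ?case by simp
  next
    case (Suc k)
    then have "(poured k, poured (Suc k)) \<in> rel body"
      unfolding body by (auto simp: poured_def fun_eq_iff)
    with Suc show ?case by (simp add: rtrancl.rtrancl_into_rtrancl)
  qed
  ultimately have star: "(s, t) \<in> (rel body)\<^sup>* \<longleftrightarrow> (\<exists>k\<le>s a. t = poured k)" for t by blast
  have "(s, t) \<in> rel (pour a cs) \<longleftrightarrow> (\<exists>k\<le>s a. t = poured k \<and> t a = 0)"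
    unfolding pour_def body_def[symmetric] rel_Seq_iff rel.simps(1,3) star by auto
  also have "\<dots> \<longleftrightarrow> t = poured (s a)"
    by (auto simp: poured_def)
  finally show ?thesis by (simp add: poured_def fun_eq_iff)
qed

text \<open>Counters can only be read destructively, so copying goes through a third counter.\<close>

definition copy :: "nat \<Rightarrow> nat \<Rightarrow> nat \<Rightarrow> prog" where
  "copy a c tmp = Seq (pour a [c, tmp]) (pour tmp [a])"

lemma rel_copy:
  assumes "distinct [a, c, tmp]" "s tmp = 0" "s c = 0"
  shows "(s, t) \<in> rel (copy a c tmp) \<longleftrightarrow> t = s(c := s a)"
proof -
  have "(s, t) \<in> rel (copy a c tmp) \<longleftrightarrow> t = (\<lambda>r. if r = tmp then 0 else
      if r = a then s a else if r = c then s a else s r)"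
    using assms unfolding copy_def rel_Seq_iff
    by (simp add: rel_pour cong: if_cong)
  also have "\<dots> \<longleftrightarrow> t = s(c := s a)"
    using assms by (intro arg_cong[where f = "(=) t"]) auto
  finally show ?thesis .
qed

fun clear :: "nat list \<Rightarrow> prog" where
  "clear [] = Do Skip"
| "clear (c # cs) = Seq (pour c []) (clear cs)"

lemma rel_clear: "(s, t) \<in> rel (clear cs) \<longleftrightarrow> t = (\<lambda>r. if r \<in> set cs then 0 else s r)"
proof (induction cs arbitrary: s)
  case (Cons c cs)
  then show ?case
    by (simp add: relcomp_unfold rel_pour) (intro arg_cong[where f = "(=) t"], auto)
qed auto

section \<open>Programs computing partial recursive functions\<close>

definition clean :: "nat \<Rightarrow> store \<Rightarrow> bool" where
  "clean b s \<longleftrightarrow> (\<forall>r\<ge>b. s r = 0)"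

text \<open>The equivalence covers both completeness and soundness, and in particular says that the
program has no terminating run when the function is undefined. Restoring all counters but
\<open>out\<close> lets programs be composed and iterated with reused scratch counters \<open>r \<ge> b\<close>.\<close>

definition implements :: "prog \<Rightarrow> recf \<Rightarrow> nat list \<Rightarrow> nat \<Rightarrow> nat \<Rightarrow> bool" where
  "implements P f ins out b \<longleftrightarrow> (\<forall>s t. clean b s \<longrightarrow> s out = 0 \<longrightarrow>
     ((s, t) \<in> rel P \<longleftrightarrow> (\<exists>y. computes f (map s ins) y \<and> t = s(out := y))))"

lemma implementsD:
  "implements P f ins out b \<Longrightarrow> clean b s \<Longrightarrow> s out = 0 \<Longrightarrow>
     (s, t) \<in> rel P \<longleftrightarrow> (\<exists>y. computes f (map s ins) y \<and> t = s(out := y))"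
  unfolding implements_def by blast

definition implementable :: "recf \<Rightarrow> bool" where
  "implementable f \<longleftrightarrow> (\<forall>ins out b. distinct (out # ins) \<longrightarrow> set (out # ins) \<subseteq> {..<b} \<longrightarrow>
     (\<exists>P. implements P f ins out b))"

lemma implementableE:
  assumes "implementable f" "distinct (out # ins)" "set (out # ins) \<subseteq> {..<b}"
  obtains P where "implements P f ins out b"
  using assms unfolding implementable_def by blast

text \<open>Terms applied to argument lists of the wrong length denote nothing. They are implemented by
a program that blocks.\<close>

lemma implementable_fail:
  assumes "\<And>s y. \<not> computes f (map s ins) y"
  shows "\<exists>P. implements P f ins out b"
proof
  show "implements (Seq (Do (Inc b)) (Do (Test b))) f ins out b"
    using assms by (auto simp: implements_def)
qed

lemma computes_simps:
  "computes Zero xs z \<longleftrightarrow> z = 0"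
  "computes Succ xs z \<longleftrightarrow> (\<exists>x. xs = [x] \<and> z = Suc x)"
  "computes (Proj i) xs z \<longleftrightarrow> i < length xs \<and> z = xs ! i"
  by (auto intro: computes.intros elim: computes_elims)

lemma computes_Comp_iff:
  "computes (Comp f gs) xs z \<longleftrightarrow> (\<exists>ys. list_all2 (\<lambda>g y. computes g xs y) gs ys \<and> computes f ys z)"
  by (metis computes.comp computes_elims(4))

lemma computes_Mu_iff:
  "computes (Mu f) xs n \<longleftrightarrow>
     computes f (n # xs) 0 \<and> (\<forall>m<n. \<exists>y. computes f (m # xs) y \<and> 0 < y)"
  by (metis computes.mu computes_elims(7))

lemma implementable_Zero: "implementable Zero"
  unfolding implementable_def
proof (intro allI impI exI)
  fix ins out b
  show "implements (Do Skip) Zero ins out b"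
    by (auto simp: implements_def computes_simps fun_upd_idem)
qed

lemma implementable_Proj: "implementable (Proj i)"
  unfolding implementable_def
proof (intro allI impI)
  fix ins :: "nat list" and out b :: nat
  assume asm: "distinct (out # ins)" "set (out # ins) \<subseteq> {..<b}"
  show "\<exists>P. implements P (Proj i) ins out b"
  proof (cases "i < length ins")
    case True
    then have "ins ! i \<in> set ins" by simp
    with asm have d: "distinct [ins ! i, out, b]" by auto
    have "implements (copy (ins ! i) out b) (Proj i) ins out b"
      unfolding implements_def
      using True by (simp add: rel_copy[OF d] clean_def computes_simps)
    then show ?thesis ..
  next
    case False
    then show ?thesis by (intro implementable_fail) (auto simp: computes_simps)
  qed
qed

lemma implementable_Succ: "implementable Succ"
  unfolding implementable_def
proof (intro allI impI)
  fix ins :: "nat list" and out b :: nat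
  assume asm: "distinct (out # ins)" "set (out # ins) \<subseteq> {..<b}"
  show "\<exists>P. implements P Succ ins out b"
  proof (cases "\<exists>a. ins = [a]")
    case True
    then obtain a where a: "ins = [a]" ..
    with asm have d: "distinct [a, out, b]" by auto
    have "implements (Seq (copy a out b) (Do (Inc out))) Succ ins out b"
      unfolding implements_def rel_Seq_iff a
      by (simp add: rel_copy[OF d] clean_def computes_simps)
    then show ?thesis ..
  next
    case False
    then show ?thesis
      by (intro implementable_fail) (auto simp: computes_simps)
  qed
qed

definition store_at :: "nat \<Rightarrow> nat list \<Rightarrow> store \<Rightarrow> store" where
  "store_at c ys s = (\<lambda>r. if c \<le> r \<and> r < c + length ys then ys ! (r - c) else s r)"

lemma store_at_Cons: "store_at (Suc c) ys (s(c := y)) = store_at c (y # ys) s"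
  by (auto simp: store_at_def fun_eq_iff nth_Cons Suc_diff_le split: nat.split)
    (metis Suc_diff_Suc Suc_le_eq nat.inject)

text \<open>The arguments of a composition are computed one after the other into consecutive fresh counters.\<close>

lemma implementable_args:
  assumes "\<forall>g\<in>set gs. implementable g"
    and "distinct ins" "set ins \<subseteq> {..<c}"
  shows "\<exists>P. \<forall>s t. clean c s \<longrightarrow> ((s, t) \<in> rel P \<longleftrightarrow>
    (\<exists>ys. list_all2 (\<lambda>g y. computes g (map s ins) y) gs ys \<and> t = store_at c ys s))"
proof -
  have "\<exists>P. \<forall>s t. clean c' s \<longrightarrow> ((s, t) \<in> rel P \<longleftrightarrow>
      (\<exists>ys. list_all2 (\<lambda>g y. computes g (map s ins) y) gs ys \<and> t = store_at c' ys s))"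
    if "c \<le> c'" for c'
    using assms(1) that
  proof (induction gs arbitrary: c')
    case Nil
    show ?case by (intro exI[of _ "Do Skip"]) (auto simp: store_at_def)
  next
    case (Cons g gs)
    obtain P where P: "implements P g ins c' (Suc c')"
    proof (rule implementableE)
      show "implementable g" "distinct (c' # ins)" "set (c' # ins) \<subseteq> {..<Suc c'}"
        using Cons.prems assms(2,3) by auto
    qed
    obtain Q where Q: "\<And>s t. clean (Suc c') s \<Longrightarrow> ((s, t) \<in> rel Q \<longleftrightarrow>
      (\<exists>ys. list_all2 (\<lambda>g y. computes g (map s ins) y) gs ys \<and> t = store_at (Suc c') ys s))"
      using Cons.IH[of "Suc c'"] Cons.prems by auto
    have "(s, t) \<in> rel (Seq P Q) \<longleftrightarrow>
        (\<exists>ys. list_all2 (\<lambda>g y. computes g (map s ins) y) (g # gs) ys \<and> t = store_at c' ys s)"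
      if s: "clean c' s" for s t
    proof -
      have 1: "(s, u) \<in> rel P \<longleftrightarrow> (\<exists>y. computes g (map s ins) y \<and> u = s(c' := y))" for u
        using s by (intro implementsD[OF P]) (auto simp: clean_def)
      have ins: "map (s(c' := y)) ins = map s ins" for y
        using assms(3) Cons.prems(2) by auto
      have 2: "(s(c' := y), t) \<in> rel Q \<longleftrightarrow>
          (\<exists>ys. list_all2 (\<lambda>g y. computes g (map s ins) y) gs ys \<and> t = store_at c' (y # ys) s)" for y
        using s by (subst Q) (auto simp: clean_def ins store_at_Cons)
      show ?thesis
      proof -
        have "(s, t) \<in> rel (Seq P Q) \<longleftrightarrow>
            (\<exists>y. computes g (map s ins) y \<and> (s(c' := y), t) \<in> rel Q)"
          unfolding rel_Seq_iff 1 by auto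
        also have "\<dots> \<longleftrightarrow> (\<exists>y ys. list_all2 (\<lambda>g y. computes g (map s ins) y) (g # gs) (y # ys) \<and>
            t = store_at c' (y # ys) s)"
          unfolding 2 by simp
        also have "\<dots> \<longleftrightarrow> (\<exists>ys. list_all2 (\<lambda>g y. computes g (map s ins) y) (g # gs) ys \<and>
            t = store_at c' ys s)"
          by (metis list_all2_Cons1)
        finally show ?thesis .
      qed
    qed
    then show ?case by blast
  qed
  from this[of c] show ?thesis by simp
qed

lemma implementable_Comp:
  assumes "implementable f" "\<forall>g\<in>set gs. implementable g"
  shows "implementable (Comp f gs)"
  unfolding implementable_def
proof (intro allI impI)
  fix ins :: "nat list" and out b :: nat
  assume asm: "distinct (out # ins)" "set (out # ins) \<subseteq> {..<b}"
  define k where "k = length gs"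
  obtain P where P: "\<And>s t. clean b s \<Longrightarrow> (s, t) \<in> rel P \<longleftrightarrow>
    (\<exists>ys. list_all2 (\<lambda>g y. computes g (map s ins) y) gs ys \<and> t = store_at b ys s)"
    using implementable_args[OF assms(2), of ins b] asm by auto
  obtain Q where Q: "implements Q f [b..<b + k] out (b + k)"
  proof (rule implementableE[OF assms(1)])
    show "distinct (out # [b..<b + k])" "set (out # [b..<b + k]) \<subseteq> {..<b + k}"
      using asm by auto
  qed
  have "implements (Seq P (Seq Q (clear [b..<b + k]))) (Comp f gs) ins out b"
    unfolding implements_def
  proof (intro allI impI)
    fix s t assume s: "clean b s" "s out = 0"
    have Qrel: "(store_at b ys s, u) \<in> rel Q \<longleftrightarrow>
        (\<exists>z. computes f ys z \<and> u = (store_at b ys s)(out := z))"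
      if "list_all2 (\<lambda>g y. computes g (map s ins) y) gs ys" for ys u
    proof -
      have "length ys = k" using that by (simp add: list_all2_lengthD k_def)
      moreover from this have "map (store_at b ys s) [b..<b + k] = ys"
        by (intro nth_equalityI) (auto simp: store_at_def)
      ultimately show ?thesis
        using s asm by (subst implementsD[OF Q]) (auto simp: clean_def store_at_def)
    qed
    have clr: "(\<lambda>r. if r \<in> set [b..<b + k] then 0 else ((store_at b ys s)(out := z)) r) = s(out := z)"
      if "list_all2 (\<lambda>g y. computes g (map s ins) y) gs ys" for ys z
    proof -
      have "length ys = k" using that by (simp add: list_all2_lengthD k_def)
      then show ?thesis using s asm by (auto simp: fun_eq_iff store_at_def clean_def)
    qed
    have "(s, t) \<in> rel (Seq P (Seq Q (clear [b..<b + k]))) \<longleftrightarrow>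
        (\<exists>ys z. list_all2 (\<lambda>g y. computes g (map s ins) y) gs ys \<and> computes f ys z \<and> t = s(out := z))"
    proof -
      define L where "L = (\<lambda>ys. list_all2 (\<lambda>g y. computes g (map s ins) y) gs ys)"
      define C where "C = (\<lambda>(u :: store) r. if r \<in> set [b..<b + k] then 0 else u r)"
      have "(s, t) \<in> rel (Seq P (Seq Q (clear [b..<b + k]))) \<longleftrightarrow>
          (\<exists>ys. L ys \<and> (\<exists>v. (store_at b ys s, v) \<in> rel Q \<and> t = C v))"
        unfolding rel_Seq_iff P[OF s(1)] rel_clear L_def C_def by blast
      also have "\<dots> \<longleftrightarrow> (\<exists>ys. L ys \<and> (\<exists>z. computes f ys z \<and> t = C ((store_at b ys s)(out := z))))"
        by (intro ex_cong1 conj_cong refl) (auto simp: Qrel L_def)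
      also have "\<dots> \<longleftrightarrow> (\<exists>ys. L ys \<and> (\<exists>z. computes f ys z \<and> t = s(out := z)))"
        unfolding C_def L_def by (intro ex_cong1 conj_cong refl) (simp only: clr)
      finally show ?thesis unfolding L_def by simp
    qed
    also have "\<dots> \<longleftrightarrow> (\<exists>z. computes (Comp f gs) (map s ins) z \<and> t = s(out := z))"
      unfolding computes_Comp_iff by auto
    finally show "(s, t) \<in> rel (Seq P (Seq Q (clear [b..<b + k]))) \<longleftrightarrow>
      (\<exists>y. computes (Comp f gs) (map s ins) y \<and> t = s(out := y))" .
  qed
  then show "\<exists>P. implements P (Comp f gs) ins out b" ..
qed

lemma PrimRec_base: "computes (PrimRec f g) (n # xs) y \<Longrightarrow> \<exists>z. computes f xs z"
  by (induction n arbitrary: y) (blast elim: computes_elims)+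

text \<open>The recursion argument \<open>n\<close> counts down while the index \<open>i\<close> of the stage counts up from \<open>0\<close>,
and \<open>out\<close> holds the value of the stage. After the loop \<open>i\<close> holds the original
argument, which is poured back into \<open>n\<close>.\<close>

lemma implementable_PrimRec:
  assumes "implementable f" "implementable g"
  shows "implementable (PrimRec f g)"
  unfolding implementable_def
proof (intro allI impI)
  fix ins :: "nat list" and out b :: nat
  assume asm: "distinct (out # ins)" "set (out # ins) \<subseteq> {..<b}"
  show "\<exists>P. implements P (PrimRec f g) ins out b"
  proof (cases ins)
    case Nil
    have "\<not> computes (PrimRec f g) [] y" for y
      by (auto elim: computes.cases)
    then show ?thesis unfolding Nil by (intro implementable_fail) simp
  next
    case (Cons n xs)
    define i where "i = b"
    define tmp where "tmp = Suc b"
    obtain F where F: "implements F f xs out b"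
    proof (rule implementableE[OF assms(1)])
      show "distinct (out # xs)" "set (out # xs) \<subseteq> {..<b}" using asm by (auto simp: Cons)
    qed
    obtain G where G: "implements G g (i # out # xs) tmp (Suc tmp)"
    proof (rule implementableE[OF assms(2)])
      show "distinct (tmp # i # out # xs)" "set (tmp # i # out # xs) \<subseteq> {..<Suc tmp}"
        using asm by (auto simp: Cons i_def tmp_def)
    qed
    have neq: "n < b" "out < b" "n \<noteq> out" "i \<noteq> tmp" "i \<noteq> n" "i \<noteq> out" "tmp \<noteq> n" "tmp \<noteq> out"
      using asm by (auto simp: Cons i_def tmp_def)
    define body where
      "body = Seq (Do (Dec n)) (Seq G (Seq (pour out []) (Seq (pour tmp [out]) (Do (Inc i)))))"
    have "implements (Seq F (Seq (Star body) (Seq (Do (Test n)) (pour i [n])))) (PrimRec f g) ins out b"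
      unfolding implements_def
    proof (intro allI impI)
      fix s t assume s: "clean b s" "s out = 0"
      define st where "st m y = s(n := s n - m, i := m, out := y)" for m y
      have body: "(st m y, v) \<in> rel body \<longleftrightarrow>
          m < s n \<and> (\<exists>z. computes g (m # y # map s xs) z \<and> v = st (Suc m) z)" for m y v
      proof -
        let ?u = "(st m y)(n := s n - Suc m)"
        have dec: "(st m y, u) \<in> exec (Dec n) \<longleftrightarrow> m < s n \<and> u = ?u" for u
          using neq by (auto simp: st_def)
        have ins: "map ?u (i # out # xs) = m # y # map s xs"
          using asm neq by (auto simp: st_def Cons i_def)
        have G': "(?u, w) \<in> rel G \<longleftrightarrow> (\<exists>z. computes g (m # y # map s xs) z \<and> w = ?u(tmp := z))" for w
          using s neq unfolding ins[symmetric]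
          by (intro implementsD[OF G]) (auto simp: clean_def st_def tmp_def i_def)
        have upd: "(?u(tmp := z), w) \<in> rel (Seq (pour out []) (Seq (pour tmp [out]) (Do (Inc i)))) \<longleftrightarrow>
            w = st (Suc m) z" for z w
        proof -
          have "(?u(tmp := z), w) \<in> rel (Seq (pour out []) (Seq (pour tmp [out]) (Do (Inc i)))) \<longleftrightarrow>
            w = (?u(tmp := 0, out := z, i := Suc m))"
            using neq
            by (simp add: relcomp_unfold rel_pour)
              (intro arg_cong[where f = "(=) w"], auto simp: st_def)
          also have "?u(tmp := 0, out := z, i := Suc m) = st (Suc m) z"
          proof -
            have "s tmp = 0" using s by (simp add: clean_def tmp_def)
            then show ?thesis using neq by (intro ext) (simp add: st_def)
          qed
          finally show ?thesis .
        qed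
        show ?thesis
          unfolding body_def rel_Seq_iff[of _ _ "Do (Dec n)"] rel_Seq_iff[of _ _ G] rel.simps(1) dec
          by (auto simp: G' upd simp del: rel.simps(2))
      qed
      have star: "(st 0 y0, t) \<in> (rel body)\<^sup>* \<longleftrightarrow>
          (\<exists>m y. m \<le> s n \<and> t = st m y \<and> computes (PrimRec f g) (m # map s xs) y)"
        if y0: "computes f (map s xs) y0" for y0 t
      proof
        assume "(st 0 y0, t) \<in> (rel body)\<^sup>*"
        then show "\<exists>m y. m \<le> s n \<and> t = st m y \<and> computes (PrimRec f g) (m # map s xs) y"
        proof induction
          case base
          then show ?case using y0 by (blast intro: computes.prim_0)
        next
          case (step u v)
          then obtain m y where my: "u = st m y" "computes (PrimRec f g) (m # map s xs) y" by blast
          from step(2) obtain z where "Suc m \<le> s n" "computes g (m # y # map s xs) z" "v = st (Suc m) z"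
            unfolding my(1) body by auto
          with my(2) show ?case by (blast intro: computes.prim_Suc)
        qed
      next
        have "m \<le> s n \<Longrightarrow> computes (PrimRec f g) (m # map s xs) y \<Longrightarrow> (st 0 y0, st m y) \<in> (rel body)\<^sup>*" for m y
        proof (induction m arbitrary: y)
          case 0
          then have "computes f (map s xs) y" by (blast elim: computes_elims)
          with y0 have "y = y0" by (blast intro: computes_deterministic)
          then show ?case by simp
        next
          case (Suc m)
          from Suc.prems(2) obtain x where
            x: "computes (PrimRec f g) (m # map s xs) x" "computes g (m # x # map s xs) y"
            by (blast elim: computes_elims)
          have "(st m x, st (Suc m) y) \<in> rel body" unfolding body using x Suc.prems(1) by auto
          moreover have "(st 0 y0, st m x) \<in> (rel body)\<^sup>*" using Suc x by auto
          ultimately show ?case by (rule rtrancl.rtrancl_into_rtrancl[rotated])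
        qed
        then show "(st 0 y0, t) \<in> (rel body)\<^sup>*"
          if "\<exists>m y. m \<le> s n \<and> t = st m y \<and> computes (PrimRec f g) (m # map s xs) y"
          using that by blast
      qed
      have finish: "(st m y, t) \<in> rel (Seq (Do (Test n)) (pour i [n])) \<longleftrightarrow> m = s n \<and> t = s(out := y)"
        if "m \<le> s n" for m y t
      proof -
        have "(st m y, t) \<in> rel (Seq (Do (Test n)) (pour i [n])) \<longleftrightarrow>
            st m y n = 0 \<and> t = (st m y)(i := 0, n := m)"
          using neq by (simp add: relcomp_unfold rel_pour)
            (intro conj_cong refl arg_cong[where f = "(=) t"], auto simp: st_def)
        also have "\<dots> \<longleftrightarrow> m = s n \<and> t = s(out := y)"
        proof (cases "m = s n")
          case True
          have "(st m y)(i := 0, n := m) = s(out := y)"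
            using s neq True by (intro ext) (simp add: st_def clean_def i_def)
          then show ?thesis using True neq by (simp add: st_def)
        next
          case False
          then show ?thesis using that neq by (simp add: st_def)
        qed
        finally show ?thesis .
      qed
      have F': "(s, u) \<in> rel F \<longleftrightarrow> (\<exists>y. computes f (map s xs) y \<and> u = st 0 y)" for u
      proof -
        have "st 0 y = s(out := y)" for y
          using s neq by (auto simp: st_def clean_def i_def fun_eq_iff)
        then show ?thesis using implementsD[OF F s] by simp
      qed
      let ?R = "\<lambda>m y. computes (PrimRec f g) (m # map s xs) y"
      let ?fin = "Seq (Do (Test n)) (pour i [n])"
      have loop: "(\<exists>v. (st 0 y0, v) \<in> (rel body)\<^sup>* \<and> (v, t) \<in> rel ?fin) \<longleftrightarrow>
          (\<exists>y. ?R (s n) y \<and> t = s(out := y))" if y0: "computes f (map s xs) y0" for y0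
      proof -
        have "(\<exists>v. (st 0 y0, v) \<in> (rel body)\<^sup>* \<and> (v, t) \<in> rel ?fin) \<longleftrightarrow>
            (\<exists>m y. m \<le> s n \<and> ?R m y \<and> (st m y, t) \<in> rel ?fin)"
          unfolding star[OF y0] by blast
        also have "\<dots> \<longleftrightarrow> (\<exists>m y. m \<le> s n \<and> ?R m y \<and> m = s n \<and> t = s(out := y))"
          by (intro ex_cong1 conj_cong refl finish)
        finally show ?thesis by auto
      qed
      have "(s, t) \<in> rel (Seq F (Seq (Star body) ?fin)) \<longleftrightarrow>
          (\<exists>y0. computes f (map s xs) y0 \<and> (\<exists>v. (st 0 y0, v) \<in> (rel body)\<^sup>* \<and> (v, t) \<in> rel ?fin))"
        unfolding rel_Seq_iff[of _ _ F] rel_Seq_iff[of _ _ "Star body"] rel.simps(3) F' by auto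
      also have "\<dots> \<longleftrightarrow> (\<exists>y0. computes f (map s xs) y0 \<and> (\<exists>y. ?R (s n) y \<and> t = s(out := y)))"
        by (intro ex_cong1 conj_cong refl loop)
      also have "\<dots> \<longleftrightarrow> (\<exists>y. computes (PrimRec f g) (map s ins) y \<and> t = s(out := y))"
        unfolding Cons using PrimRec_base by auto
      finally show "(s, t) \<in> rel (Seq F (Seq (Star body) (Seq (Do (Test n)) (pour i [n])))) \<longleftrightarrow>
        (\<exists>y. computes (PrimRec f g) (map s ins) y \<and> t = s(out := y))" .
    qed
    then show ?thesis ..
  qed
qed

text \<open>The candidate is kept in \<open>out\<close>. The decrement in the loop body lets a candidate pass
only if its value is positive; the test after the loop accepts only a candidate of value \<open>0\<close>.\<close>

lemma implementable_Mu:
  assumes "implementable f"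
  shows "implementable (Mu f)"
  unfolding implementable_def
proof (intro allI impI)
  fix ins :: "nat list" and out b :: nat
  assume asm: "distinct (out # ins)" "set (out # ins) \<subseteq> {..<b}"
  obtain F where F: "implements F f (out # ins) b (Suc b)"
  proof (rule implementableE[OF assms])
    show "distinct (b # out # ins)" "set (b # out # ins) \<subseteq> {..<Suc b}" using asm by auto
  qed
  define body where "body = Seq F (Seq (Do (Dec b)) (Seq (pour b []) (Do (Inc out))))"
  have "implements (Seq (Star body) (Seq F (Do (Test b)))) (Mu f) ins out b"
    unfolding implements_def
  proof (intro allI impI)
    fix s t assume s: "clean b s" "s out = 0"
    define st where "st m = s(out := m)" for m
    have F': "(st m, u) \<in> rel F \<longleftrightarrow> (\<exists>y. computes f (m # map s ins) y \<and> u = (st m)(b := y))" for m u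
    proof -
      have "map (st m) (out # ins) = m # map s ins" using asm by (auto simp: st_def)
      then show ?thesis
        using s asm implementsD[OF F, of "st m"] by (auto simp: clean_def st_def)
    qed
    have upd: "((st m)(b := y), v) \<in> rel (Seq (Do (Dec b)) (Seq (pour b []) (Do (Inc out)))) \<longleftrightarrow>
        0 < y \<and> v = st (Suc m)" for m y v
    proof -
      have "((st m)(b := y), v) \<in> rel (Seq (Do (Dec b)) (Seq (pour b []) (Do (Inc out)))) \<longleftrightarrow>
          0 < y \<and> v = (st m)(b := 0, out := Suc m)"
        using asm by (simp add: relcomp_unfold rel_pour)
          (intro conj_cong refl arg_cong[where f = "(=) v"], auto simp: st_def)
      also have "(st m)(b := 0, out := Suc m) = st (Suc m)"
        using s asm by (auto simp: st_def clean_def fun_eq_iff)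
      finally show ?thesis .
    qed
    have body: "(st m, v) \<in> rel body \<longleftrightarrow> (\<exists>y. computes f (m # map s ins) y \<and> 0 < y) \<and> v = st (Suc m)" for m v
      unfolding body_def rel_Seq_iff[of _ _ F] F'
      by (auto simp: upd simp del: rel.simps(2))
    have star: "(st 0, v) \<in> (rel body)\<^sup>* \<longleftrightarrow>
        (\<exists>m. v = st m \<and> (\<forall>k<m. \<exists>y. computes f (k # map s ins) y \<and> 0 < y))" for v
    proof
      assume "(st 0, v) \<in> (rel body)\<^sup>*"
      then show "\<exists>m. v = st m \<and> (\<forall>k<m. \<exists>y. computes f (k # map s ins) y \<and> 0 < y)"
      proof induction
        case (step u v)
        then obtain m where m: "u = st m" "\<forall>k<m. \<exists>y. computes f (k # map s ins) y \<and> 0 < y" by blast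
        with step(2) show ?case
          by (intro exI[of _ "Suc m"]) (auto simp: body less_Suc_eq)
      qed auto
    next
      have "\<forall>k<m. \<exists>y. computes f (k # map s ins) y \<and> 0 < y \<Longrightarrow> (st 0, st m) \<in> (rel body)\<^sup>*" for m
      proof (induction m)
        case (Suc m)
        then have "(st m, st (Suc m)) \<in> rel body" by (auto simp: body)
        with Suc show ?case by (simp add: rtrancl.rtrancl_into_rtrancl)
      qed simp
      then show "\<exists>m. v = st m \<and> (\<forall>k<m. \<exists>y. computes f (k # map s ins) y \<and> 0 < y) \<Longrightarrow>
        (st 0, v) \<in> (rel body)\<^sup>*" by blast
    qed
    have finish: "(st m, t) \<in> rel (Seq F (Do (Test b))) \<longleftrightarrow> computes f (m # map s ins) 0 \<and> t = st m" for m
    proof -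
      have "st m b = 0" using s asm by (auto simp: st_def clean_def)
      then show ?thesis unfolding rel_Seq_iff F' by (auto simp: fun_upd_idem)
    qed
    let ?pos = "\<lambda>m. \<forall>k<m. \<exists>y. computes f (k # map s ins) y \<and> 0 < y"
    have "st 0 = s" using s by (simp add: st_def fun_upd_idem)
    then have "(s, t) \<in> rel (Seq (Star body) (Seq F (Do (Test b)))) \<longleftrightarrow>
        (\<exists>v. (st 0, v) \<in> (rel body)\<^sup>* \<and> (v, t) \<in> rel (Seq F (Do (Test b))))"
      unfolding rel_Seq_iff[of _ _ "Star body"] rel.simps(3) by simp
    also have "\<dots> \<longleftrightarrow> (\<exists>m. ?pos m \<and> (st m, t) \<in> rel (Seq F (Do (Test b))))"
      unfolding star by blast
    also have "\<dots> \<longleftrightarrow> (\<exists>m. computes f (m # map s ins) 0 \<and> ?pos m \<and> t = st m)"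
      unfolding finish by blast
    also have "\<dots> \<longleftrightarrow> (\<exists>y. computes (Mu f) (map s ins) y \<and> t = s(out := y))"
      unfolding st_def computes_Mu_iff by auto
    finally show "(s, t) \<in> rel (Seq (Star body) (Seq F (Do (Test b)))) \<longleftrightarrow>
      (\<exists>y. computes (Mu f) (map s ins) y \<and> t = s(out := y))" .
  qed
  then show "\<exists>P. implements P (Mu f) ins out b" ..
qed

theorem implementable: "implementable f"
proof (induction f)
  case (Comp f gs)
  then show ?case by (intro implementable_Comp) auto
qed (simp_all add: implementable_Zero implementable_Succ implementable_Proj
      implementable_PrimRec implementable_Mu)

fun guess :: "nat list \<Rightarrow> prog" where
  "guess [] = Do Skip"
| "guess (c # cs) = Seq (Star (Do (Inc c))) (guess cs)"

lemma star_Inc: "(s, t) \<in> (exec (Inc c))\<^sup>* \<longleftrightarrow> (\<exists>m. t = s(c := s c + m))"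
proof
  assume "(s, t) \<in> (exec (Inc c))\<^sup>*"
  then show "\<exists>m. t = s(c := s c + m)"
  proof induction
    case base
    show ?case by (intro exI[of _ 0]) simp
  next
    case (step u v)
    then obtain m where "u = s(c := s c + m)" by blast
    with step(2) show ?case by (intro exI[of _ "Suc m"]) simp
  qed
next
  have "(s, s(c := s c + m)) \<in> (exec (Inc c))\<^sup>*" for m
  proof (induction m)
    case (Suc m)
    have "(s(c := s c + m), s(c := s c + Suc m)) \<in> exec (Inc c)" by simp
    with Suc show ?case by (rule rtrancl.rtrancl_into_rtrancl)
  qed simp
  then show "\<exists>m. t = s(c := s c + m) \<Longrightarrow> (s, t) \<in> (exec (Inc c))\<^sup>*" by blast
qed

lemma rel_guess:
  "(s, t) \<in> rel (guess cs) \<longleftrightarrow> (\<forall>c. s c \<le> t c \<and> (c \<notin> set cs \<longrightarrow> t c = s c))"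
proof (induction cs arbitrary: s)
  case Nil
  show ?case by (auto simp: fun_eq_iff)
next
  case (Cons a cs)
  have "(s, t) \<in> rel (guess (a # cs)) \<longleftrightarrow> (\<exists>m. (s(a := s a + m), t) \<in> rel (guess cs))"
    using star_Inc[of s _ a] by (auto simp: relcomp_unfold)
  also have "\<dots> \<longleftrightarrow> (\<forall>c. s c \<le> t c \<and> (c \<notin> set (a # cs) \<longrightarrow> t c = s c))"
  proof
    assume "\<exists>m. (s(a := s a + m), t) \<in> rel (guess cs)"
    then obtain m where m: "(s(a := s a + m)) c \<le> t c \<and>
        (c \<notin> set cs \<longrightarrow> t c = (s(a := s a + m)) c)" for c
      unfolding Cons.IH by blast
    show "\<forall>c. s c \<le> t c \<and> (c \<notin> set (a # cs) \<longrightarrow> t c = s c)"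
    proof
      fix c
      show "s c \<le> t c \<and> (c \<notin> set (a # cs) \<longrightarrow> t c = s c)"
        using m[of c] by (cases "c = a") auto
    qed
  next
    assume *: "\<forall>c. s c \<le> t c \<and> (c \<notin> set (a # cs) \<longrightarrow> t c = s c)"
    then have "s a + (t a - s a) = t a" by simp
    with * show "\<exists>m. (s(a := s a + m), t) \<in> rel (guess cs)"
      unfolding Cons.IH by (intro exI[of _ "t a - s a"]) auto
  qed
  finally show ?case .
qed

definition store_of :: "nat list \<Rightarrow> store" where
  "store_of xs = (\<lambda>c. if c < length xs then xs ! c else 0)"

lemma store_of_eqD:
  "length xs = length ys \<Longrightarrow> (\<And>c. c < length xs \<Longrightarrow> store_of xs c = store_of ys c) \<Longrightarrow> xs = ys"
  by (rule nth_equalityI) (simp_all add: store_of_def)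

text \<open>Guessing the input moves it from the start of a computation to its end: the starting store is
fixed, and the input is read off the final store, where it survives because implementations
restore their argument counters.\<close>

theorem halting_program:
  "\<exists>Q. \<forall>t. ((\<lambda>_. 0), t) \<in> rel Q \<longleftrightarrow>
    (\<exists>xs. length xs = k \<and> t = store_of xs \<and> (\<exists>y. computes g xs y))"
proof -
  obtain P where P: "implements P g [0..<k] k (Suc k)"
    by (rule implementableE[OF implementable, of k "[0..<k]" "Suc k" g]) auto
  have inputs: "((\<lambda>_. 0), s) \<in> rel (guess [0..<k]) \<longleftrightarrow> (\<exists>xs. length xs = k \<and> s = store_of xs)" for s
  proof
    assume "((\<lambda>_. 0), s) \<in> rel (guess [0..<k])"
    then have "s = store_of (map s [0..<k])" by (auto simp: rel_guess store_of_def)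
    then show "\<exists>xs. length xs = k \<and> s = store_of xs" by (intro exI[of _ "map s [0..<k]"]) simp
  qed (auto simp: rel_guess store_of_def)
  have run: "(store_of xs, t) \<in> rel (Seq P (pour k [])) \<longleftrightarrow> (\<exists>y. computes g xs y) \<and> t = store_of xs"
    if "length xs = k" for xs t
  proof -
    have "map (store_of xs) [0..<k] = xs"
      using that by (intro nth_equalityI) (auto simp: store_of_def)
    then have "(store_of xs, u) \<in> rel P \<longleftrightarrow> (\<exists>y. computes g xs y \<and> u = (store_of xs)(k := y))" for u
      using that implementsD[OF P, of "store_of xs" u] by (simp add: clean_def store_of_def)
    moreover have "((store_of xs)(k := y), t) \<in> rel (pour k []) \<longleftrightarrow> t = store_of xs" for y
    proof -
      have "(\<lambda>r. if r = k then 0 else ((store_of xs)(k := y)) r) = store_of xs"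
        using that by (auto simp: store_of_def)
      moreover have "((store_of xs)(k := y), t) \<in> rel (pour k []) \<longleftrightarrow>
          t = (\<lambda>r. if r = k then 0 else ((store_of xs)(k := y)) r)"
        by (subst rel_pour) (simp, simp, simp only: list.set empty_iff if_False)
      ultimately show ?thesis by (simp only:)
    qed
    ultimately show ?thesis unfolding rel_Seq_iff by auto
  qed
  have "((\<lambda>_. 0), t) \<in> rel (Seq (guess [0..<k]) (Seq P (pour k []))) \<longleftrightarrow>
      (\<exists>xs. length xs = k \<and> t = store_of xs \<and> (\<exists>y. computes g xs y))" for t
  proof -
    have "((\<lambda>_. 0), t) \<in> rel (Seq (guess [0..<k]) (Seq P (pour k []))) \<longleftrightarrow>
        (\<exists>xs. length xs = k \<and> (store_of xs, t) \<in> rel (Seq P (pour k [])))"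
      unfolding rel_Seq_iff[of _ _ "guess [0..<k]"] inputs by blast
    also have "\<dots> \<longleftrightarrow> (\<exists>xs. length xs = k \<and> (\<exists>y. computes g xs y) \<and> t = store_of xs)"
      by (intro ex_cong1 conj_cong refl run)
    finally show ?thesis by blast
  qed
  then show ?thesis by blast
qed

section \<open>Programs as finite labelled graphs\<close>

text \<open>A control state is the stack of programs that remain to be executed. No program calls itself, so
only finitely many stacks arise from a given program.\<close>

type_synonym node = "prog list"

fun edges :: "node \<Rightarrow> (instr \<times> node) list" where
  "edges [] = []"
| "edges (Do i # K) = [(i, K)]"
| "edges (Seq P Q # K) = [(Skip, P # Q # K)]"
| "edges (Star P # K) = [(Skip, K), (Skip, P # Star P # K)]"

definition steps :: "((node \<times> store) \<times> (node \<times> store)) set" where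
  "steps = {((K, s), (K', s')). \<exists>i. (i, K') \<in> set (edges K) \<and> (s, s') \<in> exec i}"

fun rel_node :: "node \<Rightarrow> (store \<times> store) set" where
  "rel_node [] = Id"
| "rel_node (P # K) = rel P O rel_node K"

lemma edge_rel_node:
  "(i, K') \<in> set (edges K) \<Longrightarrow> exec i O rel_node K' \<subseteq> rel_node K"
proof (induction K rule: edges.induct)
  case (4 P K)
  then consider "i = Skip" "K' = K" | "i = Skip" "K' = P # Star P # K" by auto
  then show ?case
  proof cases
    case 2
    then show ?thesis by (auto intro: converse_rtrancl_into_rtrancl)
  qed auto
qed auto

lemma rel_imp_steps: "(s, t) \<in> rel P \<Longrightarrow> ((P # K, s), (K, t)) \<in> steps\<^sup>*"
proof (induction P arbitrary: s t K)
  case (Do i)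
  then have "((Do i # K, s), (K, t)) \<in> steps" by (auto simp: steps_def)
  then show ?case ..
next
  case (Seq P Q)
  then obtain u where "(s, u) \<in> rel P" "(u, t) \<in> rel Q" by auto
  then have "((P # Q # K, s), (K, t)) \<in> steps\<^sup>*"
    using Seq.IH by (meson rtrancl_trans)
  moreover have "((Seq P Q # K, s), (P # Q # K, s)) \<in> steps" by (simp add: steps_def)
  ultimately show ?case by (meson converse_rtrancl_into_rtrancl)
next
  case (Star P)
  have "((Star P # K, s), (Star P # K, t)) \<in> steps\<^sup>*"
    using Star.prems[unfolded rel.simps]
  proof induction
    case (step u v)
    have "((Star P # K, u), (P # Star P # K, u)) \<in> steps" by (simp add: steps_def)
    moreover have "((P # Star P # K, u), (Star P # K, v)) \<in> steps\<^sup>*"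
      using Star.IH[OF step(2)] .
    ultimately show ?case using step.IH by (meson converse_rtrancl_into_rtrancl rtrancl_trans)
  qed simp
  moreover have "((Star P # K, t), (K, t)) \<in> steps" by (simp add: steps_def)
  ultimately show ?case by (rule rtrancl.rtrancl_into_rtrancl)
qed

theorem steps_iff_rel: "(([P], s), ([], t)) \<in> steps\<^sup>* \<longleftrightarrow> (s, t) \<in> rel P"
proof
  have "(s, t) \<in> rel_node K" if "((K, s), ([], t)) \<in> steps\<^sup>*" for K
    using that
  proof (induction "(K, s)" arbitrary: K s rule: converse_rtrancl_induct)
    case (step c)
    obtain K' s' where c: "c = (K', s')" by (cases c)
    from step(1) obtain i where "(i, K') \<in> set (edges K)" "(s, s') \<in> exec i"
      by (auto simp: steps_def c)
    with edge_rel_node step.hyps(3)[OF c] show ?case by blast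
  qed simp
  from this[of "[P]"] show "(([P], s), ([], t)) \<in> steps\<^sup>* \<Longrightarrow> (s, t) \<in> rel P" by simp
qed (rule rel_imp_steps)

text \<open>\<open>conts P K\<close> collects the stacks that occur while \<open>P\<close> is executed on top of \<open>K\<close>, with \<open>K\<close> itself left out.\<close>

fun conts :: "prog \<Rightarrow> node \<Rightarrow> node set" where
  "conts (Do i) K = {Do i # K}"
| "conts (Seq P Q) K = insert (Seq P Q # K) (conts P (Q # K) \<union> conts Q K)"
| "conts (Star P) K = insert (Star P # K) (conts P (Star P # K))"

lemma finite_conts: "finite (conts P K)"
  by (induction P arbitrary: K) auto

lemma start_in_conts: "P # K \<in> conts P K"
  by (cases P) auto

lemma edges_conts: "X \<in> conts P K \<Longrightarrow> (i, Y) \<in> set (edges X) \<Longrightarrow> Y \<in> insert K (conts P K)"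
proof (induction P arbitrary: K)
  case (Seq P Q)
  then show ?case using start_in_conts[of P "Q # K"] start_in_conts[of Q K] by auto
next
  case (Star P)
  then show ?case using start_in_conts[of P "Star P # K"] by auto
qed auto

definition nodes :: "prog \<Rightarrow> node set" where
  "nodes P = insert [] (conts P [])"

lemma finite_nodes: "finite (nodes P)"
  by (simp add: nodes_def finite_conts)

lemma nodes_closed: "X \<in> nodes P \<Longrightarrow> (i, Y) \<in> set (edges X) \<Longrightarrow> Y \<in> nodes P"
  using edges_conts[of X P "[]" i Y] by (auto simp: nodes_def)

fun touched :: "instr \<Rightarrow> nat set" where
  "touched Skip = {}"
| "touched (Inc c) = {c}"
| "touched (Dec c) = {c}"
| "touched (Test c) = {c}"

lemma counters_bounded: "\<exists>N. \<forall>X\<in>nodes P. \<forall>(i, Y)\<in>set (edges X). touched i \<subseteq> {..<N}"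
proof -
  have "finite (\<Union>X\<in>nodes P. \<Union>(i, Y)\<in>set (edges X). touched i)"
    by (auto simp: finite_nodes intro!: finite_UN_I split: prod.splits) (metis finite.simps touched.elims)
  then obtain N where "(\<Union>X\<in>nodes P. \<Union>(i, Y)\<in>set (edges X). touched i) \<subseteq> {..<N}"
    using finite_nat_set_iff_bounded[of "\<Union>X\<in>nodes P. \<Union>(i, Y)\<in>set (edges X). touched i"] by blast
  then show ?thesis by blast
qed

section \<open>Weighted words and the reduction to two letters\<close>

definition vmul :: "'i set \<Rightarrow> ('i \<Rightarrow> 'a) \<Rightarrow> ('i \<Rightarrow> 'i \<Rightarrow> 'a) \<Rightarrow> 'i \<Rightarrow> 'a :: comm_semiring_1" where
  "vmul I v A = (\<lambda>y. \<Sum>x\<in>I. v x * A x y)"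

definition vrun :: "'i set \<Rightarrow> (nat \<Rightarrow> 'i \<Rightarrow> 'i \<Rightarrow> 'a) \<Rightarrow> ('i \<Rightarrow> 'a) \<Rightarrow> nat list \<Rightarrow> 'i \<Rightarrow> 'a :: comm_semiring_1" where
  "vrun I A v w = foldl (\<lambda>v i. vmul I v (A i)) v w"

definition uvec :: "'i \<Rightarrow> 'i \<Rightarrow> 'a :: comm_semiring_1" where
  "uvec x = (\<lambda>y. if y = x then 1 else 0)"

lemma vrun_simps [simp]:
  "vrun I A v [] = v"
  "vrun I A v (i # w) = vrun I A (vmul I v (A i)) w"
  "vrun I A v (w @ w') = vrun I A (vrun I A v w) w'"
  by (simp_all add: vrun_def)

lemma vmul_zero [simp]: "vmul I (\<lambda>_. 0) A = (\<lambda>_. 0)"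
  by (simp add: vmul_def)

lemma vrun_zero [simp]: "vrun I A (\<lambda>_. 0) w = (\<lambda>_. 0)"
  by (induction w) simp_all

lemma vmul_uvec: "finite I \<Longrightarrow> x \<in> I \<Longrightarrow> vmul I (uvec x) A = A x"
  unfolding vmul_def uvec_def
  by (auto simp: if_distrib[of "\<lambda>a. a * _"] cong: if_cong)

text \<open>Indices are paired with a phase below \<open>r\<close>. Shifting out of the last phase gives zero.\<close>

fun shift_phase :: "nat \<Rightarrow> nat \<times> 'i \<Rightarrow> nat \<times> 'i \<Rightarrow> 'a :: comm_semiring_1" where
  "shift_phase r (j, x) (k, y) = (if k = Suc j \<and> k < r \<and> y = x then 1 else 0)"

fun apply_phase :: "(nat \<Rightarrow> 'i \<Rightarrow> 'i \<Rightarrow> 'a) \<Rightarrow> nat \<times> 'i \<Rightarrow> nat \<times> 'i \<Rightarrow> 'a :: comm_semiring_1" where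
  "apply_phase A (j, x) (k, y) = (if k = 0 then A j x y else 0)"

definition at_phase :: "nat \<Rightarrow> ('i \<Rightarrow> 'a) \<Rightarrow> nat \<times> 'i \<Rightarrow> 'a :: comm_semiring_1" where
  "at_phase j v = (\<lambda>(k, x). if k = j then v x else 0)"

lemma uvec_Pair: "uvec (j, x) = at_phase j (uvec x)"
  by (auto simp: uvec_def at_phase_def fun_eq_iff)

lemma at_phase_0 [simp]: "at_phase j (\<lambda>_. 0) = (\<lambda>_. 0)"
  by (auto simp: at_phase_def)

locale letters =
  fixes I :: "'i set" and r :: nat and A :: "nat \<Rightarrow> 'i \<Rightarrow> 'i \<Rightarrow> 'a :: comm_semiring_1"
  assumes finite_I: "finite I"
    and outside: "j < r \<Longrightarrow> x \<in> I \<Longrightarrow> y \<notin> I \<Longrightarrow> A j x y = 0"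
begin

definition J :: "(nat \<times> 'i) set" where "J = {..<r} \<times> I"

definition gen :: "nat \<Rightarrow> nat \<times> 'i \<Rightarrow> nat \<times> 'i \<Rightarrow> 'a" where
  "gen b = (if b = 0 then shift_phase r else apply_phase A)"

definition code_word :: "nat \<Rightarrow> nat list" where
  "code_word i = replicate i 0 @ [1]"

definition supported :: "('i \<Rightarrow> 'a) \<Rightarrow> bool" where
  "supported v \<longleftrightarrow> (\<forall>x. x \<notin> I \<longrightarrow> v x = 0)"

lemma supported_vmul: "j < r \<Longrightarrow> supported (vmul I v (A j))"
  unfolding supported_def vmul_def by (auto simp: outside intro!: sum.neutral)

lemma supported_uvec: "x \<in> I \<Longrightarrow> supported (uvec x)"
  unfolding supported_def uvec_def by auto

lemma supported_vrun: "supported v \<Longrightarrow> set u \<subseteq> {..<r} \<Longrightarrow> supported (vrun I A v u)"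
  by (induction u arbitrary: v) (simp_all add: supported_vmul)

lemma vmul_gen_0:
  assumes "j < r" "supported v"
  shows "vmul J (at_phase j v) (gen 0) = (if Suc j < r then at_phase (Suc j) v else (\<lambda>_. 0))"
proof (rule ext, safe)
  fix k y
  have "(\<Sum>z\<in>J. at_phase j v z * gen 0 z (k, y)) =
      (\<Sum>z\<in>J. if z = (j, y) then (if k = Suc j \<and> k < r then v y else 0) else 0)"
    by (intro sum.cong refl) (auto simp: at_phase_def gen_def split: if_splits)
  also have "\<dots> = (if k = Suc j \<and> k < r then v y else 0)"
    using assms finite_I by (auto simp: J_def supported_def)
  finally show "vmul J (at_phase j v) (gen 0) (k, y) =
      (if Suc j < r then at_phase (Suc j) v else (\<lambda>_. 0)) (k, y)"
    by (auto simp: vmul_def at_phase_def)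
qed

lemma vmul_gen_1:
  assumes "j < r" "b \<noteq> 0"
  shows "vmul J (at_phase j v) (gen b) = at_phase 0 (vmul I v (A j))"
proof (rule ext, safe)
  fix k y
  have "(\<Sum>z\<in>J. at_phase j v z * gen b z (k, y)) =
      (\<Sum>i<r. \<Sum>x\<in>I. at_phase j v (i, x) * gen b (i, x) (k, y))"
    unfolding J_def by (simp add: sum.cartesian_product case_prod_unfold)
  also have "\<dots> = (\<Sum>i<r. if i = j then at_phase 0 (vmul I v (A j)) (k, y) else 0)"
    using assms by (intro sum.cong refl) (auto simp: at_phase_def gen_def vmul_def)
  also have "\<dots> = at_phase 0 (vmul I v (A j)) (k, y)"
    using assms by simp
  finally show "vmul J (at_phase j v) (gen b) (k, y) = at_phase 0 (vmul I v (A j)) (k, y)"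
    by (simp add: vmul_def)
qed

text \<open>From a vector concentrated in one phase, every word over the two letters either overflows the
phases or does the work of some word over the \<open>r\<close> matrices. There are no mixed results, because both
letters act on all indices of a phase alike.\<close>

lemma vrun_gen_cases:
  assumes "j < r" "supported v"
  shows "vrun J gen (at_phase j v) w = (\<lambda>_. 0) \<or>
    (\<exists>k u. set u \<subseteq> {..<r} \<and> vrun J gen (at_phase j v) w = at_phase k (vrun I A v u))"
  using assms
proof (induction w arbitrary: j v)
  case Nil
  have "vrun J gen (at_phase j v) [] = at_phase j (vrun I A v [])" by simp
  then show ?case by (metis empty_subsetI list.set(1))
next
  case (Cons b w)
  show ?case
  proof (cases "b = 0")
    case True
    then show ?thesis using Cons by (simp add: vmul_gen_0)
  next
    case False
    then have eq: "vrun J gen (at_phase j v) (b # w) = vrun J gen (at_phase 0 (vmul I v (A j))) w"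
      using Cons.prems by (simp add: vmul_gen_1)
    have "0 < r" using Cons.prems by simp
    from Cons.IH[OF this supported_vmul[OF Cons.prems(1), of v]] show ?thesis
    proof (elim disjE exE conjE)
      fix k u
      assume "set u \<subseteq> {..<r}" and
        "vrun J gen (at_phase 0 (vmul I v (A j))) w = at_phase k (vrun I A (vmul I v (A j)) u)"
      then have "set (j # u) \<subseteq> {..<r}"
        "vrun J gen (at_phase j v) (b # w) = at_phase k (vrun I A v (j # u))"
        using Cons.prems(1) eq by simp_all
      then show ?thesis by blast
    next
      assume "vrun J gen (at_phase 0 (vmul I v (A j))) w = (\<lambda>_. 0)"
      then show ?thesis unfolding eq by blast
    qed
  qed
qed

lemma vrun_replicate_0:
  "j < r \<Longrightarrow> supported v \<Longrightarrow> vrun J gen (at_phase j v) (replicate m 0) =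
    (if j + m < r then at_phase (j + m) v else (\<lambda>_. 0))"
  by (induction m arbitrary: j) (auto simp: vmul_gen_0)

lemma vrun_code_word:
  assumes "j < r" "supported v"
  shows "vrun J gen (at_phase j v) (code_word i) =
    (if j + i < r then at_phase 0 (vmul I v (A (j + i))) else (\<lambda>_. 0))"
  using assms by (simp add: code_word_def vrun_replicate_0 vmul_gen_1)

lemma vrun_code_words:
  "0 < r \<Longrightarrow> supported v \<Longrightarrow> set u \<subseteq> {..<r} \<Longrightarrow>
    vrun J gen (at_phase 0 v) (concat (map code_word u)) = at_phase 0 (vrun I A v u)"
  by (induction u arbitrary: v) (simp_all add: vrun_code_word supported_vmul)

theorem two_letters_sound:
  assumes eq: "\<And>z. z \<in> J \<Longrightarrow> vrun J gen (uvec (0, x)) w z = at_phase 0 \<eta> z"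
    and "\<eta> \<noteq> (\<lambda>_. 0)" "supported \<eta>" "0 < r" "x \<in> I"
  shows "\<exists>u. set u \<subseteq> {..<r} \<and> vrun I A (uvec x) u = \<eta>"
proof -
  obtain y where y: "\<eta> y \<noteq> 0" using assms(2) by auto
  then have "(0, y) \<in> J" using assms(3,4) by (auto simp: J_def supported_def)
  from eq[OF this] y have nz: "vrun J gen (at_phase 0 (uvec x)) w (0, y) \<noteq> 0"
    by (simp add: at_phase_def uvec_Pair)
  then obtain k u where u: "set u \<subseteq> {..<r}"
    "vrun J gen (at_phase 0 (uvec x)) w = at_phase k (vrun I A (uvec x) u)"
    using vrun_gen_cases[OF assms(4) supported_uvec[OF assms(5)], of w] by auto
  with nz have "k = 0" by (auto simp: at_phase_def split: if_splits)
  have "vrun I A (uvec x) u z = \<eta> z" for z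
  proof (cases "z \<in> I")
    case True
    then have "(0, z) \<in> J" using assms(4) by (simp add: J_def)
    from eq[OF this] show ?thesis using u(2) \<open>k = 0\<close> by (simp add: at_phase_def uvec_Pair)
  next
    case False
    then show ?thesis
      using assms(3) supported_vrun[OF supported_uvec[OF assms(5)] u(1)] by (simp add: supported_def)
  qed
  then show ?thesis using u(1) by blast
qed

text \<open>The code word of the matrix with number \<open>r - 1\<close> comes first: it overflows every phase but \<open>0\<close>, and in
phase \<open>0\<close> it applies a matrix with only one nonzero row. Hence every start except \<open>(0, x)\<close> ends in zero.\<close>

theorem two_letters_complete:
  assumes "set u \<subseteq> {..<r}" "0 < r" "x \<in> I"
    and "\<And>y. y \<in> I \<Longrightarrow> y \<noteq> x \<Longrightarrow> A (r - 1) y = (\<lambda>_. 0)"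
  shows "\<exists>w. w \<noteq> [] \<and> set w \<subseteq> {..<2} \<and>
    vrun J gen (uvec (0, x)) w = at_phase 0 (vrun I A (A (r - 1) x) u) \<and>
    (\<forall>z\<in>J. z \<noteq> (0, x) \<longrightarrow> vrun J gen (uvec z) w = (\<lambda>_. 0))"
proof (intro exI conjI ballI impI)
  define w where "w = code_word (r - 1) @ concat (map code_word u)"
  show "w \<noteq> []" "set w \<subseteq> {..<2}" by (auto simp: w_def code_word_def)
  have sup: "supported (A (r - 1) x)"
    using supported_vmul[of "r - 1" "uvec x"] assms by (simp add: vmul_uvec finite_I)
  show "vrun J gen (uvec (0, x)) w = at_phase 0 (vrun I A (A (r - 1) x) u)"
    using assms sup
    by (simp add: w_def uvec_Pair vrun_code_word supported_uvec vmul_uvec finite_I vrun_code_words)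
  fix z assume "z \<in> J" "z \<noteq> (0, x)"
  then obtain j y where z: "z = (j, y)" "j < r" "y \<in> I" "j = 0 \<longrightarrow> y \<noteq> x" by (auto simp: J_def)
  \<comment> \<open>the first code word already annihilates the vector\<close>
  have "vrun J gen (uvec z) (code_word (r - 1)) = (\<lambda>_. 0)"
    using z assms(2,4) by (cases "j = 0") (auto simp: uvec_Pair vrun_code_word supported_uvec vmul_uvec finite_I)
  then show "vrun J gen (uvec z) w = (\<lambda>_. 0)" by (simp add: w_def)
qed

end

section \<open>The max-plus automaton of a program\<close>

text \<open>\<^term>\<open>Plus c\<close> and \<^term>\<open>Minus c\<close> hold the value of counter \<open>c\<close> and its negative, \<^term>\<open>Err\<close> the largest violation so
far, \<^term>\<open>Node K\<close> the mark of the control state, and \<^term>\<open>Start\<close> is the index from which the initial configuration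
is created.\<close>

datatype index = Start | Plus nat | Minus nat | Err | Node node

type_synonym transition = "node \<times> instr \<times> node"

fun delta :: "instr \<Rightarrow> nat \<Rightarrow> int" where
  "delta (Inc c) d = (if d = c then 1 else 0)"
| "delta (Dec c) d = (if d = c then - 1 else 0)"
| "delta _ d = 0"

fun weight :: "transition \<Rightarrow> index \<Rightarrow> index \<Rightarrow> zmax" where
  "weight (X, i, Y) (Node K) (Node K') = (if K = X \<and> K' = Y then 1 else 0)"
| "weight (X, i, Y) (Plus c) (Plus d) = (if c = d then Fin (delta i c) else 0)"
| "weight (X, i, Y) (Minus c) (Minus d) = (if c = d then Fin (- delta i c) else 0)"
| "weight (X, i, Y) Err Err = 1"
| "weight (X, i, Y) (Plus c) Err = (if i = Test c then 1 else 0)"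
| "weight (X, i, Y) (Minus c) Err = (if i = Dec c then Fin 1 else 0)"
| "weight _ _ _ = 0"

fun conf :: "nat \<Rightarrow> node \<Rightarrow> store \<Rightarrow> index \<Rightarrow> zmax" where
  "conf N K s (Node K') = (if K' = K then 1 else 0)"
| "conf N K s (Plus c) = (if c < N then Fin (int (s c)) else 0)"
| "conf N K s (Minus c) = (if c < N then Fin (- int (s c)) else 0)"
| "conf N K s Err = 1"
| "conf N K s Start = 0"

definition positive :: "zmax \<Rightarrow> bool" where
  "positive z \<longleftrightarrow> (\<exists>e>0. z = Fin e)"

lemma positive_add: "positive x \<Longrightarrow> positive (x + y)"
  by (cases y) (auto simp: positive_def max_def)

text \<open>A vector is beyond repair if a violation has been recorded or no control state is marked. The entry
at \<^term>\<open>Start\<close> has to be zero too, since a computation can be started afresh from it.\<close>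

definition dead :: "(index \<Rightarrow> zmax) \<Rightarrow> bool" where
  "dead v \<longleftrightarrow> v Start = 0 \<and> (positive (v Err) \<or> (\<forall>K. v (Node K) = 0))"

lemma dead_zero: "dead (\<lambda>_. 0)"
  by (simp add: dead_def)

lemma conf_not_dead: "\<not> dead (conf N K s)"
  by (auto simp: dead_def positive_def one_zmax_def zero_zmax_def)

lemma sum_single:
  assumes "finite S" "\<And>x. x \<in> S \<Longrightarrow> x \<noteq> a \<Longrightarrow> f x = 0"
  shows "sum f S = (if a \<in> S then f a else (0 :: 'b :: comm_monoid_add))"
proof (cases "a \<in> S")
  case True
  then have "sum f S = f a + sum f (S - {a})" using assms(1) by (simp add: sum.remove)
  also have "sum f (S - {a}) = 0" using assms(2) by (intro sum.neutral) auto
  finally show ?thesis using True by simp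
qed (use assms in \<open>auto intro: sum.neutral\<close>)

locale automaton =
  fixes P :: prog and N :: nat
  assumes counters: "\<And>X i Y. X \<in> nodes P \<Longrightarrow> (i, Y) \<in> set (edges X) \<Longrightarrow> touched i \<subseteq> {..<N}"
begin

definition I :: "index set" where
  "I = {Start, Err} \<union> Plus ` {..<N} \<union> Minus ` {..<N} \<union> Node ` nodes P"

definition transitions :: "transition set" where
  "transitions = {(X, i, Y). X \<in> nodes P \<and> (i, Y) \<in> set (edges X)}"

lemma in_I [simp]:
  "Start \<in> I" "Err \<in> I" "Plus c \<in> I \<longleftrightarrow> c < N" "Minus c \<in> I \<longleftrightarrow> c < N" "Node K \<in> I \<longleftrightarrow> K \<in> nodes P"
  by (auto simp: I_def)

lemma finite_I: "finite I"
  by (simp add: I_def finite_nodes)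

lemma finite_transitions: "finite transitions"
proof -
  have "transitions = (SIGMA X:nodes P. set (edges X))" by (auto simp: transitions_def)
  then show ?thesis by (simp add: finite_nodes)
qed

definition transition_list :: "transition list" where
  "transition_list = (SOME ts. set ts = transitions)"

lemma set_transition_list: "set transition_list = transitions"
  unfolding transition_list_def by (rule someI_ex) (rule finite_list[OF finite_transitions])

definition r :: nat where "r = Suc (length transition_list)"

definition start_weight :: "index \<Rightarrow> index \<Rightarrow> zmax" where
  "start_weight x = (if x = Start then conf N [P] (\<lambda>_. 0) else (\<lambda>_. 0))"

definition A :: "nat \<Rightarrow> index \<Rightarrow> index \<Rightarrow> zmax" where
  "A j = (if j < length transition_list then weight (transition_list ! j) else start_weight)"

lemma A_cases:
  assumes "j < r"
  obtains X i Y where "(X, i, Y) \<in> transitions" "A j = weight (X, i, Y)"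
  | "j = r - 1" "A j = start_weight"
proof (cases "j < length transition_list")
  case True
  obtain X i Y where tr: "transition_list ! j = (X, i, Y)" by (cases "transition_list ! j")
  have "transition_list ! j \<in> set transition_list" using True by (rule nth_mem)
  then show ?thesis using that(1) True by (simp add: tr set_transition_list A_def)
next
  case False
  then show ?thesis using that(2) assms by (simp add: A_def r_def)
qed

lemma A_last: "A (r - 1) = start_weight"
  by (simp add: A_def r_def)

lemma transition_is_letter: "tr \<in> transitions \<Longrightarrow> \<exists>j<r. A j = weight tr"
proof -
  assume "tr \<in> transitions"
  then obtain j where "j < length transition_list" "transition_list ! j = tr"
    using set_transition_list by (metis in_set_conv_nth)
  then show ?thesis by (intro exI[of _ j]) (simp add: A_def r_def)
qed

lemma transition_nodes: "(X, i, Y) \<in> transitions \<Longrightarrow> X \<in> nodes P \<and> Y \<in> nodes P"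
  using nodes_closed by (auto simp: transitions_def)

lemma transition_touched: "(X, i, Y) \<in> transitions \<Longrightarrow> touched i \<subseteq> {..<N}"
  using counters by (auto simp: transitions_def)

lemma start_node: "[P] \<in> nodes P"
  by (simp add: nodes_def start_in_conts)

lemma conf_outside: "K \<in> nodes P \<Longrightarrow> y \<notin> I \<Longrightarrow> conf N K s y = 0"
  by (cases y) auto

lemma weight_outside:
  assumes "(X, i, Y) \<in> transitions" "x \<in> I" "y \<notin> I"
  shows "weight (X, i, Y) x y = 0"
  using assms transition_nodes[OF assms(1)] by (cases x; cases y) auto

sublocale letters I r A
proof
  fix j x y assume "j < r" "x \<in> I" "y \<notin> I"
  then show "A j x y = 0"
    using weight_outside conf_outside[OF start_node]
    by (cases rule: A_cases[of j]) (auto simp: start_weight_def)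
qed (rule finite_I)

lemma vmul_weight_Node:
  assumes "(X, i, Y) \<in> transitions"
  shows "vmul I v (weight (X, i, Y)) (Node K) = (if K = Y then v (Node X) else 0)"
proof -
  have "weight (X, i, Y) x (Node K) = 0" if "x \<noteq> Node X" for x using that by (cases x) auto
  then show ?thesis
    unfolding vmul_def using transition_nodes[OF assms]
    by (subst sum_single[OF finite_I, of "Node X"]) auto
qed

lemma vmul_weight_Plus:
  "vmul I v (weight (X, i, Y)) (Plus c) = (if c < N then v (Plus c) * Fin (delta i c) else 0)"
proof -
  have "weight (X, i, Y) x (Plus c) = 0" if "x \<noteq> Plus c" for x using that by (cases x) auto
  then show ?thesis
    unfolding vmul_def by (subst sum_single[OF finite_I, of "Plus c"]) auto
qed

lemma vmul_weight_Minus: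
  "vmul I v (weight (X, i, Y)) (Minus c) = (if c < N then v (Minus c) * Fin (- delta i c) else 0)"
proof -
  have "weight (X, i, Y) x (Minus c) = 0" if "x \<noteq> Minus c" for x using that by (cases x) auto
  then show ?thesis
    unfolding vmul_def by (subst sum_single[OF finite_I, of "Minus c"]) auto
qed

lemma vmul_weight_Start: "vmul I v (weight (X, i, Y)) Start = 0"
proof -
  have "weight (X, i, Y) x Start = 0" for x by (cases x) auto
  then show ?thesis by (simp add: vmul_def)
qed

text \<open>A violation is positive exactly if the guard fails: \<open>c > 0\<close> for a zero test, \<open>1 - c > 0\<close> for a
decrement. The error entry of a configuration is \<open>0\<close> and so absorbs a violation that is not positive.\<close>

fun violation :: "instr \<Rightarrow> (index \<Rightarrow> zmax) \<Rightarrow> zmax" where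
  "violation (Test c) v = v (Plus c)"
| "violation (Dec c) v = v (Minus c) * Fin 1"
| "violation _ v = 0"

lemma vmul_weight_Err:
  assumes "(X, i, Y) \<in> transitions"
  shows "vmul I v (weight (X, i, Y)) Err = v Err + violation i v"
proof -
  have "vmul I v (weight (X, i, Y)) Err =
      v Err + (\<Sum>x\<in>I - {Err}. v x * weight (X, i, Y) x Err)"
    unfolding vmul_def by (subst sum.remove[OF finite_I, of Err]) auto
  also have "(\<Sum>x\<in>I - {Err}. v x * weight (X, i, Y) x Err) = violation i v"
  proof (cases i)
    case (Test c)
    have "weight (X, i, Y) x Err = 0" if "x \<noteq> Plus c" "x \<noteq> Err" for x
      using that by (cases x) (auto simp: Test)
    then show ?thesis
      using transition_touched[OF assms] finite_I
      by (subst sum_single[of _ "Plus c"]) (auto simp: Test)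
  next
    case (Dec c)
    have "weight (X, i, Y) x Err = 0" if "x \<noteq> Minus c" "x \<noteq> Err" for x
      using that by (cases x) (auto simp: Dec)
    then show ?thesis
      using transition_touched[OF assms] finite_I
      by (subst sum_single[of _ "Minus c"]) (auto simp: Dec)
  next
    case Skip
    have "weight (X, i, Y) x Err = 0" if "x \<noteq> Err" for x
      using that by (cases x) (auto simp: Skip)
    then show ?thesis by (simp add: Skip)
  next
    case (Inc c)
    have "weight (X, i, Y) x Err = 0" if "x \<noteq> Err" for x
      using that by (cases x) (auto simp: Inc)
    then show ?thesis by (simp add: Inc)
  qed
  finally show ?thesis .
qed

lemma step_enabled:
  assumes tr: "(X, i, Y) \<in> transitions" and ex: "(s, s') \<in> exec i"
  shows "vmul I (conf N X s) (weight (X, i, Y)) = conf N Y s'"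
proof
  fix y
  show "vmul I (conf N X s) (weight (X, i, Y)) y = conf N Y s' y"
  proof (cases y)
    case (Plus c)
    show ?thesis unfolding Plus vmul_weight_Plus using ex by (cases i) auto
  next
    case (Minus c)
    show ?thesis unfolding Minus vmul_weight_Minus using ex by (cases i) auto
  next
    case Err
    show ?thesis
      unfolding Err vmul_weight_Err[OF tr] using ex transition_touched[OF tr]
      by (cases i) (auto simp: one_zmax_def zero_zmax_def)
  next
    case (Node K)
    show ?thesis unfolding Node vmul_weight_Node[OF tr] by simp
  qed (simp add: vmul_weight_Start)
qed

lemma step_disabled:
  assumes tr: "(X, i, Y) \<in> transitions" and dis: "K \<noteq> X \<or> (\<forall>s'. (s, s') \<notin> exec i)"
  shows "dead (vmul I (conf N K s) (weight (X, i, Y)))"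
proof (cases "K = X")
  case True
  then have "positive (vmul I (conf N K s) (weight (X, i, Y)) Err)"
    unfolding vmul_weight_Err[OF tr]
    using dis transition_touched[OF tr]
    by (cases i) (auto simp: positive_def one_zmax_def max_def)
  then show ?thesis by (simp add: dead_def vmul_weight_Start)
next
  case False
  then show ?thesis by (simp add: dead_def vmul_weight_Start vmul_weight_Node[OF tr])
qed

lemma dead_step:
  assumes tr: "(X, i, Y) \<in> transitions" and "dead v"
  shows "dead (vmul I v (weight (X, i, Y)))"
  using assms(2) unfolding dead_def
  by (auto simp: vmul_weight_Start vmul_weight_Node[OF tr] vmul_weight_Err[OF tr] positive_add)

lemma vmul_start_weight: "vmul I v start_weight = (\<lambda>y. v Start * conf N [P] (\<lambda>_. 0) y)"
  unfolding vmul_def by (rule ext, subst sum_single[OF finite_I, of Start]) (auto simp: start_weight_def)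

definition reached :: "(index \<Rightarrow> zmax) \<Rightarrow> bool" where
  "reached v \<longleftrightarrow> (\<exists>K s. K \<in> nodes P \<and> (([P], \<lambda>_. 0), (K, s)) \<in> steps\<^sup>* \<and> v = conf N K s)"

text \<open>A letter that does not fit the present configuration makes the vector dead, and dead vectors
stay dead; so a vector that is a configuration again was produced by a genuine computation.\<close>

lemma vrun_invariant:
  "set u \<subseteq> {..<r} \<Longrightarrow> vrun I A (uvec Start) u = uvec Start \<or> reached (vrun I A (uvec Start) u)
    \<or> dead (vrun I A (uvec Start) u)"
proof (induction u rule: rev_induct)
  case (snoc j u)
  define v where "v = vrun I A (uvec Start) u"
  have run: "vrun I A (uvec Start) (u @ [j]) = vmul I v (A j)" by (simp add: v_def)
  have v: "v = uvec Start \<or> reached v \<or> dead v" and j: "j < r" using snoc by (auto simp: v_def)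
  from j have "reached (vmul I v (A j)) \<or> dead (vmul I v (A j))"
  proof (cases rule: A_cases)
    case (1 X i Y)
    from v show ?thesis
    proof (elim disjE)
      assume "v = uvec Start"
      moreover have "weight (X, i, Y) Start y = 0" for y by (cases y) auto
      ultimately show ?thesis using dead_zero by (simp add: 1 vmul_uvec finite_I)
    next
      assume "reached v"
      then obtain K s where K: "K \<in> nodes P" "(([P], \<lambda>_. 0), (K, s)) \<in> steps\<^sup>*" "v = conf N K s"
        by (auto simp: reached_def)
      show ?thesis
      proof (cases "K = X \<and> (\<exists>s'. (s, s') \<in> exec i)")
        case True
        then obtain s' where s': "K = X" "(s, s') \<in> exec i" by blast
        then have "((K, s), (Y, s')) \<in> steps" using 1(1) by (auto simp: steps_def transitions_def)
        then have "reached (conf N Y s')"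
          using rtrancl.rtrancl_into_rtrancl[OF K(2)] transition_nodes[OF 1(1)]
          unfolding reached_def by blast
        then show ?thesis using step_enabled[OF 1(1) s'(2)] by (simp add: 1(2) K(3) s'(1))
      next
        case False
        then show ?thesis using step_disabled[OF 1(1)] by (simp add: 1(2) K(3))
      qed
    next
      assume "dead v"
      then show ?thesis using dead_step[OF 1(1)] by (simp add: 1(2))
    qed
  next
    case 2
    from v show ?thesis
    proof (elim disjE)
      assume "v = uvec Start"
      then have "vmul I v (A j) = conf N [P] (\<lambda>_. 0)"
        unfolding 2(2) by (simp add: vmul_uvec finite_I start_weight_def)
      then show ?thesis using start_node by (auto simp: reached_def)
    next
      assume "reached v"
      then have "v Start = 0" by (auto simp: reached_def)
      then show ?thesis using dead_zero unfolding 2(2) by (simp add: vmul_start_weight)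
    next
      assume "dead v"
      then have "v Start = 0" by (simp add: dead_def)
      then show ?thesis using dead_zero unfolding 2(2) by (simp add: vmul_start_weight)
    qed
  qed
  then show ?case unfolding run by blast
qed simp

lemma steps_realised:
  assumes "(([P], \<lambda>_. 0), (K, s)) \<in> steps\<^sup>*"
  shows "K \<in> nodes P \<and> (\<exists>u. set u \<subseteq> {..<r} \<and> vrun I A (conf N [P] (\<lambda>_. 0)) u = conf N K s)"
  using assms
proof (induction "(K, s)" arbitrary: K s rule: rtrancl_induct)
  case base
  show ?case using start_node by (auto intro!: exI[of _ "[]"])
next
  case (step c)
  obtain K' s' where c: "c = (K', s')" by (cases c)
  from step(3)[OF c] obtain u where u: "K' \<in> nodes P" "set u \<subseteq> {..<r}"
    "vrun I A (conf N [P] (\<lambda>_. 0)) u = conf N K' s'" by blast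
  from step(2) obtain i where i: "(i, K) \<in> set (edges K')" "(s', s) \<in> exec i"
    by (auto simp: steps_def c)
  then have tr: "(K', i, K) \<in> transitions" using u(1) by (simp add: transitions_def)
  then obtain j where j: "j < r" "A j = weight (K', i, K)" using transition_is_letter by blast
  then have "vrun I A (conf N [P] (\<lambda>_. 0)) (u @ [j]) = conf N K s"
    using u(3) step_enabled[OF tr i(2)] by simp
  moreover have "set (u @ [j]) \<subseteq> {..<r}" using u(2) j(1) by simp
  ultimately show ?case using transition_nodes[OF tr] by blast
qed

text \<open>A vector only shows the counters below \<^term>\<open>N\<close>, hence the agreement of stores on these alone.\<close>

theorem reach_sound:
  assumes "set u \<subseteq> {..<r}" "vrun I A (uvec Start) u = conf N K s"
  shows "\<exists>s'. (([P], \<lambda>_. 0), (K, s')) \<in> steps\<^sup>* \<and> (\<forall>c<N. s' c = s c)"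
proof -
  have "conf N K s \<noteq> uvec Start" by (auto simp: uvec_def one_zmax_def zero_zmax_def dest: fun_cong[of _ _ Start])
  then obtain K' s' where *: "(([P], \<lambda>_. 0), (K', s')) \<in> steps\<^sup>*" "conf N K s = conf N K' s'"
    using vrun_invariant[OF assms(1)] unfolding assms(2) by (auto simp: reached_def conf_not_dead)
  have "K' = K" using fun_cong[OF *(2), of "Node K"] by (auto split: if_splits)
  moreover have "s' c = s c" if "c < N" for c using fun_cong[OF *(2), of "Plus c"] that by simp
  ultimately show ?thesis using *(1) by blast
qed

theorem reach_complete:
  assumes "(([P], \<lambda>_. 0), (K, s)) \<in> steps\<^sup>*"
  shows "\<exists>u. set u \<subseteq> {..<r} \<and> vrun I A (A (r - 1) Start) u = conf N K s"
  using steps_realised[OF assms] unfolding A_last start_weight_def by simp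

end

section \<open>Matrices indexed by a list of states\<close>

definition mat_of :: "'i list \<Rightarrow> ('i \<Rightarrow> 'i \<Rightarrow> 'a) \<Rightarrow> 'a mat" where
  "mat_of L A = mat (length L) (length L) (\<lambda>(i, j). A (L ! i) (L ! j))"

definition row_of :: "'i list \<Rightarrow> ('i \<Rightarrow> 'a) \<Rightarrow> 'a mat" where
  "row_of L v = mat 1 (length L) (\<lambda>(i, j). v (L ! j))"

lemma mat_of_carrier [simp]: "mat_of L A \<in> carrier_mat (length L) (length L)"
  by (simp add: mat_of_def)

lemma row_of_carrier [simp]: "row_of L v \<in> carrier_mat 1 (length L)"
  by (simp add: row_of_def)

lemma row_of_eq_iff: "row_of L v = row_of L v' \<longleftrightarrow> (\<forall>x\<in>set L. v x = v' x)"
proof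
  assume eq: "row_of L v = row_of L v'"
  show "\<forall>x\<in>set L. v x = v' x"
  proof
    fix x assume "x \<in> set L"
    then obtain j where "j < length L" "L ! j = x" by (auto simp: in_set_conv_nth)
    then show "v x = v' x" using arg_cong[OF eq, of "\<lambda>M. M $$ (0, j)"] by (simp add: row_of_def)
  qed
qed (auto simp: row_of_def)

lemma sum_nth_distinct:
  "distinct L \<Longrightarrow> (\<Sum>i = 0..<length L. f (L ! i)) = sum f (set L)"
  using sum.reindex_bij_betw[OF bij_betw_nth[OF _ refl refl], of L f]
  by (simp add: atLeast0LessThan)

lemma row_of_mult_mat_of:
  assumes "distinct L"
  shows "row_of L v * mat_of L A = row_of L (vmul (set L) v A)"
proof (rule eq_matI)
  fix i j assume "i < dim_row (row_of L (vmul (set L) v A))" "j < dim_col (row_of L (vmul (set L) v A))"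
  then have ij: "i = 0" "j < length L" by (auto simp: row_of_def)
  then have "(row_of L v * mat_of L A) $$ (i, j) = (\<Sum>k = 0..<length L. v (L ! k) * A (L ! k) (L ! j))"
    by (simp add: row_of_def mat_of_def scalar_prod_def)
  also have "\<dots> = vmul (set L) v A (L ! j)"
    unfolding vmul_def by (rule sum_nth_distinct[OF assms])
  finally show "(row_of L v * mat_of L A) $$ (i, j) = row_of L (vmul (set L) v A) $$ (i, j)"
    using ij by (simp add: row_of_def)
qed (simp_all add: row_of_def mat_of_def)

lemma foldl_row_of:
  assumes "distinct L" "\<And>b. b < length Bs \<Longrightarrow> Bs ! b = mat_of L (A b)" "set w \<subseteq> {..<length Bs}"
  shows "foldl (\<lambda>v i. v * Bs ! i) (row_of L v) w = row_of L (vrun (set L) A v w)"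
  using assms(3) by (induction w arbitrary: v) (simp_all add: row_of_mult_mat_of assms)

lemma foldr_mat_carrier:
  fixes Bs :: "'a :: comm_semiring_1 mat list"
  assumes "set Bs \<subseteq> carrier_mat n n" "set w \<subseteq> {..<length Bs}"
  shows "foldr (\<lambda>i B. Bs ! i * B) w (1\<^sub>m n) \<in> carrier_mat n n"
  using assms(2)
proof (induction w)
  case (Cons i w)
  then have "Bs ! i \<in> carrier_mat n n" using assms(1) nth_mem by fastforce
  with Cons show ?case by simp
qed simp

lemma foldl_eq_mult_foldr:
  fixes Bs :: "'a :: comm_semiring_1 mat list"
  assumes "set Bs \<subseteq> carrier_mat n n" "set w \<subseteq> {..<length Bs}" "v \<in> carrier_mat m n"
  shows "foldl (\<lambda>v i. v * Bs ! i) v w = v * foldr (\<lambda>i B. Bs ! i * B) w (1\<^sub>m n)"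
  using assms(2,3)
proof (induction w arbitrary: v)
  case (Cons i w)
  then have i: "Bs ! i \<in> carrier_mat n n" using assms(1) nth_mem by fastforce
  with Cons show ?case
    using assoc_mult_mat[OF Cons.prems(2) i foldr_mat_carrier[OF assms(1), of w]] by simp
next
  case Nil
  then show ?case by (simp add: right_mult_one_mat[OF Nil(2)])
qed

lemma unit_row_mult:
  fixes C :: "'a :: comm_semiring_1 mat"
  assumes "distinct L" "C \<in> carrier_mat (length L) (length L)" "i < length L" "j < length L"
  shows "(row_of L (uvec (L ! i)) * C) $$ (0, j) = C $$ (i, j)"
proof -
  have "(row_of L (uvec (L ! i)) * C) $$ (0, j) =
      (\<Sum>k = 0..<length L. uvec (L ! i) (L ! k) * C $$ (k, j))"
    using assms by (simp add: row_of_def scalar_prod_def)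
  also have "\<dots> = (\<Sum>k = 0..<length L. if k = i then C $$ (k, j) else 0)"
    using assms by (intro sum.cong refl) (auto simp: uvec_def nth_eq_iff_index_eq)
  finally show ?thesis using assms by simp
qed

text \<open>A product of matrices is determined by its rows, and each row is the result of letting a unit vector run
through the word.\<close>

lemma foldr_eq_mat_of_iff:
  fixes A :: "nat \<Rightarrow> 'i \<Rightarrow> 'i \<Rightarrow> 'a :: comm_semiring_1"
  assumes L: "distinct L" and Bs: "\<And>b. b < length Bs \<Longrightarrow> Bs ! b = mat_of L (A b)"
    and w: "set w \<subseteq> {..<length Bs}"
  shows "foldr (\<lambda>i B. Bs ! i * B) w (1\<^sub>m (length L)) = mat_of L M \<longleftrightarrow>
    (\<forall>x\<in>set L. \<forall>y\<in>set L. vrun (set L) A (uvec x) w y = M x y)"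
proof -
  define C where "C = foldr (\<lambda>i B. Bs ! i * B) w (1\<^sub>m (length L))"
  have car: "set Bs \<subseteq> carrier_mat (length L) (length L)"
    using Bs by (auto simp: in_set_conv_nth)
  have C: "C \<in> carrier_mat (length L) (length L)"
    unfolding C_def by (rule foldr_mat_carrier[OF car w])
  have entry: "C $$ (i, j) = vrun (set L) A (uvec (L ! i)) w (L ! j)"
    if ij: "i < length L" "j < length L" for i j
  proof -
    have "C $$ (i, j) = (row_of L (uvec (L ! i)) * C) $$ (0, j)"
      using unit_row_mult[OF L C ij] by simp
    also have "row_of L (uvec (L ! i)) * C = row_of L (vrun (set L) A (uvec (L ! i)) w)"
      unfolding C_def foldl_eq_mult_foldr[OF car w row_of_carrier, symmetric]
      by (rule foldl_row_of[OF L Bs w])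
    finally show ?thesis using ij by (simp add: row_of_def)
  qed
  have "C = mat_of L M \<longleftrightarrow> (\<forall>i<length L. \<forall>j<length L. C $$ (i, j) = M (L ! i) (L ! j))"
    using C by (auto simp: mat_of_def intro!: eq_matI)
  also have "\<dots> \<longleftrightarrow> (\<forall>x\<in>set L. \<forall>y\<in>set L. vrun (set L) A (uvec x) w y = M x y)"
    unfolding all_set_conv_all_nth using entry by auto
  finally show ?thesis unfolding C_def .
qed

lemma mat_code_row_of: "mat_code (row_of L v) = list_encode [list_encode (map (\<lambda>y. zmax_code (v y)) L)]"
proof -
  have "map zmax_code (map (\<lambda>j. row_of L v $$ (0, j)) [0..<length L]) = map (\<lambda>y. zmax_code (v y)) L"
    by (intro nth_equalityI) (auto simp: row_of_def)
  moreover have "mat_to_list (row_of L v) = [map (\<lambda>j. row_of L v $$ (0, j)) [0..<length L]]"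
    by (simp add: mat_to_list_def row_of_def)
  ultimately show ?thesis by (simp add: mat_code_def)
qed

lemma mat_code_mat_of:
  "mat_code (mat_of L A) = list_encode (map (\<lambda>x. list_encode (map (\<lambda>y. zmax_code (A x y)) L)) L)"
proof -
  have "map (\<lambda>row. list_encode (map zmax_code row)) (mat_to_list (mat_of L A)) =
      map (\<lambda>x. list_encode (map (\<lambda>y. zmax_code (A x y)) L)) L"
    by (intro nth_equalityI)
      (auto simp: mat_to_list_def mat_of_def comp_def intro!: arg_cong[of _ _ list_encode] nth_equalityI)
  then show ?thesis by (simp add: mat_code_def)
qed

section \<open>Recursive functions for the codes of instances\<close>

lemma computes_Comp1:
  "computes g xs a \<Longrightarrow> computes f [a] y \<Longrightarrow> computes (Comp f [g]) xs y"
  by (rule computes.comp[where ys = "[a]"]) simp_all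

lemma computes_Comp2:
  "computes g xs a \<Longrightarrow> computes h xs b \<Longrightarrow> computes f [a, b] y \<Longrightarrow> computes (Comp f [g, h]) xs y"
  by (rule computes.comp[where ys = "[a, b]"]) simp_all

definition add_rec :: recf where "add_rec = PrimRec (Proj 0) (Comp Succ [Proj 1])"

lemma computes_add: "computes add_rec [x, y] (x + y)"
proof (induction x)
  case 0
  show ?case unfolding add_rec_def by (intro computes.prim_0) (simp add: computes_simps)
next
  case (Suc x)
  show ?case
    using Suc unfolding add_rec_def
    by (auto intro!: computes.prim_Suc computes_Comp1 simp: computes_simps)
qed

definition pred_rec :: recf where "pred_rec = PrimRec Zero (Proj 0)"

lemma computes_pred: "computes pred_rec [x] (x - 1)"
proof (induction x)
  case 0
  show ?case unfolding pred_rec_def by (intro computes.prim_0) (simp add: computes_simps)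
next
  case (Suc x)
  show ?case
    using Suc unfolding pred_rec_def by (auto intro!: computes.prim_Suc simp: computes_simps)
qed

definition triangle_rec :: recf where
  "triangle_rec = PrimRec Zero (Comp Succ [Comp add_rec [Proj 0, Proj 1]])"

lemma computes_triangle: "computes triangle_rec [x] (triangle x)"
proof (induction x)
  case 0
  show ?case unfolding triangle_rec_def by (intro computes.prim_0) (simp add: computes_simps)
next
  case (Suc x)
  have "computes (Comp add_rec [Proj 0, Proj 1]) [x, triangle x] (x + triangle x)"
    by (rule computes_Comp2[OF _ _ computes_add]) (simp_all add: computes_simps)
  then have "computes (Comp Succ [Comp add_rec [Proj 0, Proj 1]]) [x, triangle x] (triangle (Suc x))"
    by (rule computes_Comp1) (simp add: computes_simps)
  with Suc show ?case unfolding triangle_rec_def by (rule computes.prim_Suc)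
qed

definition pair_rec :: recf where
  "pair_rec = Comp add_rec [Comp triangle_rec [add_rec], Proj 0]"

lemma computes_pair: "computes pair_rec [x, y] (prod_encode (x, y))"
  unfolding pair_rec_def prod_encode_def
  using computes_Comp2[OF computes_Comp1[OF computes_add computes_triangle] _ computes_add, of "Proj 0" x y x]
  by (simp add: computes_simps)

definition cons_rec :: "recf \<Rightarrow> recf \<Rightarrow> recf" where
  "cons_rec g h = Comp Succ [Comp pair_rec [g, h]]"

lemma computes_cons:
  "computes g xs a \<Longrightarrow> computes h xs (list_encode as) \<Longrightarrow> computes (cons_rec g h) xs (list_encode (a # as))"
  unfolding cons_rec_def
  by (rule computes_Comp1[OF computes_Comp2[OF _ _ computes_pair]]) (simp_all add: computes_simps)

lemma computes_append:
  "list_all2 (\<lambda>g a. computes g xs a) gs as \<Longrightarrow> computes h xs (list_encode bs) \<Longrightarrow>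
    computes (foldr cons_rec gs h) xs (list_encode (as @ bs))"
  by (induction rule: list_all2_induct) (simp_all add: computes_cons del: list_encode.simps)

lemma computes_list:
  "list_all2 (\<lambda>g a. computes g xs a) gs as \<Longrightarrow> computes (foldr cons_rec gs Zero) xs (list_encode as)"
  using computes_append[of xs gs as Zero "[]"] by (simp add: computes_simps)

definition plus_rec :: "nat \<Rightarrow> recf" where
  "plus_rec i = Comp Succ [Comp add_rec [Proj i, Proj i]]"

definition minus_rec :: "nat \<Rightarrow> recf" where
  "minus_rec i = Comp Succ [Comp pred_rec [Comp add_rec [Proj i, Proj i]]]"

lemma computes_plus: "i < length xs \<Longrightarrow> computes (plus_rec i) xs (Suc (2 * xs ! i))"
  unfolding plus_rec_def
  by (rule computes_Comp1[OF computes_Comp2[OF _ _ computes_add]]) (simp_all add: computes_simps mult_2)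

lemma computes_minus: "i < length xs \<Longrightarrow> computes (minus_rec i) xs (Suc (2 * xs ! i - 1))"
  unfolding minus_rec_def
  by (rule computes_Comp1[OF computes_Comp1[OF computes_Comp2[OF _ _ computes_add] computes_pred]])
    (simp_all add: computes_simps mult_2)

text \<open>The code of the row \<open>(-\<infinity>, x\<^sub>1, -x\<^sub>1, x\<^sub>2, -x\<^sub>2, \<dots>)\<close> followed by entries with the codes \<open>tail\<close>. The
code of \<open>-x\<close> is \<open>2 * x\<close>, except for \<open>x = 0\<close>, where truncated subtraction gives the right value \<open>1\<close>.\<close>

definition row_code :: "nat list \<Rightarrow> nat list \<Rightarrow> nat" where
  "row_code xs tail = list_encode (0 # concat (map (\<lambda>x. [Suc (2 * x), Suc (2 * x - 1)]) xs) @ tail)"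

definition row_rec :: "nat \<Rightarrow> nat \<Rightarrow> recf" where
  "row_rec k t = foldr cons_rec (Zero # concat (map (\<lambda>i. [plus_rec i, minus_rec i]) [0..<k])) (Proj t)"

lemma computes_row:
  assumes "length xs = k" "t < k" "xs ! t = list_encode tail"
  shows "computes (row_rec k t) xs (row_code xs tail)"
proof -
  have prefix: "list_all2 (\<lambda>g a. computes g xs a)
      (concat (map (\<lambda>i. [plus_rec i, minus_rec i]) is))
      (concat (map (\<lambda>x. [Suc (2 * x), Suc (2 * x - 1)]) (map ((!) xs) is)))"
    if "set is \<subseteq> {..<k}" for "is"
    using that assms(1)
    by (induction "is") (simp_all add: computes_plus computes_minus del: One_nat_def)
  have sub: "set [0..<k] \<subseteq> {..<k}" by auto
  have eq: "map ((!) xs) [0..<k] = xs" using map_nth[of xs] assms(1) by simp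
  have "list_all2 (\<lambda>g a. computes g xs a)
      (concat (map (\<lambda>i. [plus_rec i, minus_rec i]) [0..<k]))
      (concat (map (\<lambda>x. [Suc (2 * x), Suc (2 * x - 1)]) xs))"
    using prefix[OF sub] unfolding eq .
  then have *: "list_all2 (\<lambda>g a. computes g xs a)
      (Zero # concat (map (\<lambda>i. [plus_rec i, minus_rec i]) [0..<k]))
      (0 # concat (map (\<lambda>x. [Suc (2 * x), Suc (2 * x - 1)]) xs))"
    by (simp add: computes.zero del: One_nat_def)
  from computes_append[OF *, of "Proj t" tail] show ?thesis
    using assms by (simp add: row_rec_def row_code_def computes_simps del: list_encode.simps)
qed

text \<open>\<open>F\<close> assembles the code of an instance from four arguments, and \<open>D\<close> answers \<open>0\<close> or \<open>1\<close>. The function to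
be minimised ignores the minimisation variable, which is argument \<open>0\<close>: the search ends at once if the
answer is \<open>0\<close> and never if it is \<open>1\<close>.\<close>

definition diag_rec :: "recf \<Rightarrow> recf \<Rightarrow> recf" where
  "diag_rec D F = Mu (Comp D [Comp F (map Proj [1..<5])])"

lemma diag_rec_halts_iff:
  assumes "length xs = 4" "computes F xs c" "computes D [c] (if b then 1 else 0)"
  shows "(\<exists>y. computes (diag_rec D F) xs y) \<longleftrightarrow> \<not> b"
proof -
  have D: "computes (Comp D [Comp F (map Proj [1..<5])]) (m # xs) (if b then 1 else 0)" for m
  proof (rule computes_Comp1[OF _ assms(3)])
    have "list_all2 (\<lambda>g y. computes g (m # xs) y) (map Proj [1..<5]) xs"
      using assms(1) by (auto simp: list_all2_conv_all_nth computes_simps)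
    then show "computes (Comp F (map Proj [1..<5])) (m # xs) c" using assms(2) by (rule computes.comp)
  qed
  show ?thesis
  proof
    assume "\<exists>y. computes (diag_rec D F) xs y"
    then obtain m where "computes (Comp D [Comp F (map Proj [1..<5])]) (m # xs) 0"
      unfolding diag_rec_def computes_Mu_iff by blast
    with D[of m] have "(if b then 1 else 0) = (0 :: nat)" by (rule computes_deterministic)
    then show "\<not> b" by (simp split: if_splits)
  next
    assume "\<not> b"
    with D[of 0] show "\<exists>y. computes (diag_rec D F) xs y"
      unfolding diag_rec_def computes_Mu_iff by (intro exI[of _ 0]) simp
  qed
qed

section \<open>Undecidability\<close>

lemma zmax_code_counter:
  "zmax_code (Fin (int x)) = Suc (2 * x)" "zmax_code (Fin (- int x)) = Suc (2 * x - 1)"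
proof -
  show "zmax_code (Fin (int x)) = Suc (2 * x)"
    by (simp add: int_encode_def sum_encode_def)
  show "zmax_code (Fin (- int x)) = Suc (2 * x - 1)"
    by (cases x) (simp_all add: int_encode_def sum_encode_def nat_add_distrib)
qed

text \<open>\<open>n\<close>, \<open>As\<close>, \<open>\<alpha>\<close>, \<open>tail\<close> and \<open>zs\<close> are chosen before the arguments \<open>xs\<close>. This is what allows their own
codes to be used as arguments.\<close>

theorem
  fixes g :: recf and k :: nat
  shows matrix_instances_for: "\<exists>n As tail zs. \<forall>xs. length xs = k \<longrightarrow> (\<exists>M.
      mat_code M = list_encode (row_code xs tail # zs) \<and> (n, As, M) \<in> matrix_instances 2 \<and>
      (matrix_reachable (n, As, M) \<longleftrightarrow> (\<exists>y. computes g xs y)))"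
    and vector_instances_for: "\<exists>n As \<alpha> tail. \<forall>xs. length xs = k \<longrightarrow> (\<exists>\<eta>.
      mat_code \<eta> = list_encode [row_code xs tail] \<and> (n, As, \<alpha>, \<eta>) \<in> vector_instances 2 \<and>
      (vector_reachable (n, As, \<alpha>, \<eta>) \<longleftrightarrow> (\<exists>y. computes g xs y)))"
proof -
  obtain Q where Q: "\<And>t. ((\<lambda>_. 0), t) \<in> rel Q \<longleftrightarrow>
      (\<exists>xs. length xs = k \<and> t = store_of xs \<and> (\<exists>y. computes g xs y))"
    using halting_program[of k g] by blast
  obtain N0 where N0: "\<forall>X\<in>nodes Q. \<forall>(i, Y)\<in>set (edges X). touched i \<subseteq> {..<N0}"
    using counters_bounded[of Q] by blast
  define N where "N = max N0 k"
  interpret automaton Q N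
  proof
    fix X i Y assume X: "X \<in> nodes Q" and Y: "(i, Y) \<in> set (edges X)"
    have "touched i \<subseteq> {..<N0}" using bspec[OF bspec[OF N0 X] Y] by simp
    then show "touched i \<subseteq> {..<N}" by (auto simp: N_def)
  qed
  have kN: "k \<le> N" by (simp add: N_def)
  have r0: "0 < r" by (simp add: r_def)
  let ?start = "(0 :: nat, Start)"
  \<comment> \<open>the entries that depend on the arguments come first, so that they form a prefix of the coded row\<close>
  define front where "front = ?start # concat (map (\<lambda>c. [(0, Plus c), (0, Minus c)]) [0..<k])"
  have front_set: "set front = insert ?start (\<Union>c<k. {(0, Plus c), (0, Minus c)})"
    by (auto simp: front_def)
  have front_J: "set front \<subseteq> J"
    using kN r0 by (auto simp: front_set J_def)
  have front_distinct: "distinct front"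
  proof -
    have "distinct (?start # concat (map (\<lambda>c. [(0, Plus c), (0, Minus c)]) [0..<m]))" for m
      by (induction m) auto
    then show ?thesis by (simp add: front_def)
  qed
  have "finite J" by (simp add: J_def finite_I)
  then obtain rest where rest: "set rest = J - set front" "distinct rest"
    using finite_distinct_list[of "J - set front"] by auto
  define L where "L = front @ rest"
  have L: "distinct L" "set L = J"
    using front_distinct front_J rest by (auto simp: L_def)
  have L0: "L = ?start # tl L" by (simp add: L_def front_def)
  define Bs where "Bs = [mat_of L (gen 0), mat_of L (gen 1)]"
  have Bs: "Bs ! b = mat_of L (gen b)" if "b < length Bs" for b
  proof -
    have "b = 0 \<or> b = 1" using that by (auto simp: Bs_def)
    then show ?thesis by (auto simp: Bs_def)
  qed
  define target where "target xs = at_phase 0 (conf N [] (store_of xs))" for xs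
  define only_first where
    "only_first xs = (\<lambda>z. if z = ?start then target xs else (\<lambda>_. 0))" for xs
  \<comment> \<open>outside the prefix the target shows no argument, so the empty argument list gives the right entries\<close>
  define tail where "tail = map (\<lambda>z. zmax_code (target [] z)) rest"
  define zs where "zs = map (\<lambda>_. list_encode (map (\<lambda>_. 0) L)) (tl L)"
  have target_code: "list_encode (map (\<lambda>z. zmax_code (target xs z)) L) = row_code xs tail"
    if xs: "length xs = k" for xs
  proof -
    have mid': "map (\<lambda>z. zmax_code (target xs z)) (concat (map (\<lambda>c. [(0, Plus c), (0, Minus c)]) [0..<m])) =
        concat (map (\<lambda>x. [Suc (2 * x), Suc (2 * x - 1)]) (map ((!) xs) [0..<m]))" if "m \<le> k" for m
      using that kN xs
      by (induction m) (simp_all add: target_def at_phase_def zmax_code_counter store_of_def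
          del: zmax_code.simps One_nat_def)
    have mid: "map (\<lambda>z. zmax_code (target xs z))
          (concat (map (\<lambda>c. [(0, Plus c), (0, Minus c)]) [0..<k])) =
        concat (map (\<lambda>x. [Suc (2 * x), Suc (2 * x - 1)]) xs)"
    proof -
      have "map ((!) xs) [0..<k] = xs" using map_nth[of xs] xs by simp
      then show ?thesis using mid'[OF order_refl] by (simp only:)
    qed
    have "target xs z = target [] z" if z: "z \<in> set rest" for z
    proof -
      obtain j x where jx: "z = (j, x)" by (cases z)
      have "z \<notin> set front" using z rest by simp
      then show ?thesis
        using xs unfolding jx front_set target_def at_phase_def
        by (cases x) (auto simp: store_of_def)
    qed
    then have "map (\<lambda>z. zmax_code (target xs z)) rest = tail" by (simp add: tail_def)
    moreover have "zmax_code (target xs ?start) = 0"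
      by (simp add: target_def at_phase_def zero_zmax_def)
    ultimately show ?thesis
      by (simp add: row_code_def L_def front_def mid del: list_encode.simps)
  qed
  have halts_iff: "(([Q], \<lambda>_. 0), ([], store_of xs)) \<in> steps\<^sup>* \<longleftrightarrow> (\<exists>y. computes g xs y)"
    if xs: "length xs = k" for xs
  proof -
    have "xs' = xs" if "length xs' = k" "store_of xs = store_of xs'" for xs'
      using that xs store_of_eqD[of xs xs'] by simp
    then show ?thesis unfolding steps_iff_rel Q using xs by metis
  qed
  have sound: "\<exists>y. computes g xs y"
    if xs: "length xs = k" and eq: "\<And>z. z \<in> J \<Longrightarrow> vrun J gen (uvec ?start) w z = target xs z" for xs w
  proof -
    have "conf N [] (store_of xs) Err \<noteq> 0" by simp
    then have "conf N [] (store_of xs) \<noteq> (\<lambda>_. 0)" by metis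
    moreover have "supported (conf N [] (store_of xs))"
      unfolding supported_def by (intro allI impI conf_outside) (simp_all add: nodes_def)
    ultimately obtain u where "set u \<subseteq> {..<r}" "vrun I A (uvec Start) u = conf N [] (store_of xs)"
      using two_letters_sound[of Start w "conf N [] (store_of xs)"] eq r0 by (auto simp: target_def)
    then obtain s where s: "(([Q], \<lambda>_. 0), ([], s)) \<in> steps\<^sup>*" "\<forall>c<N. s c = store_of xs c"
      using reach_sound by blast
    then obtain xs' where xs': "length xs' = k" "s = store_of xs'" "\<exists>y. computes g xs' y"
      unfolding steps_iff_rel Q by blast
    have "xs' = xs"
      using xs xs'(1) s(2) kN unfolding xs'(2) by (intro store_of_eqD) simp_all
    then show ?thesis using xs'(3) by simp
  qed
  have complete: "\<exists>w. w \<noteq> [] \<and> set w \<subseteq> {..<2} \<and> vrun J gen (uvec ?start) w = target xs \<and>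
      (\<forall>z\<in>J. z \<noteq> ?start \<longrightarrow> vrun J gen (uvec z) w = (\<lambda>_. 0))"
    if xs: "length xs = k" and halts: "\<exists>y. computes g xs y" for xs
  proof -
    from halts have "(([Q], \<lambda>_. 0), ([], store_of xs)) \<in> steps\<^sup>*" using halts_iff[OF xs] by simp
    then obtain u where u: "set u \<subseteq> {..<r}" "vrun I A (A (r - 1) Start) u = conf N [] (store_of xs)"
      using reach_complete by blast
    have "A (r - 1) y = (\<lambda>_. 0)" if "y \<noteq> Start" for y
      using that unfolding A_last start_weight_def by simp
    then show ?thesis
      using two_letters_complete[OF u(1) r0, of Start] unfolding u(2) target_def by simp
  qed
  have len: "length Bs = 2" "set Bs \<subseteq> carrier_mat (length L) (length L)" "1 \<le> length L"
    using L0 by (auto simp: Bs_def) (metis Suc_leI length_Cons zero_less_Suc)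
  have vec: "vector_reachable (length L, Bs, row_of L (uvec ?start), row_of L (target xs)) \<longleftrightarrow>
      (\<exists>y. computes g xs y)" if xs: "length xs = k" for xs
  proof -
    have "vector_reachable (length L, Bs, row_of L (uvec ?start), row_of L (target xs)) \<longleftrightarrow>
        (\<exists>w. w \<noteq> [] \<and> set w \<subseteq> {..<2} \<and> (\<forall>z\<in>J. vrun J gen (uvec ?start) w z = target xs z))"
      using foldl_row_of[of L Bs gen, OF L(1) Bs]
      by (auto simp: len(1) row_of_eq_iff L(2))
    also have "\<dots> \<longleftrightarrow> (\<exists>y. computes g xs y)"
      using sound[OF xs] complete[OF xs] by metis
    finally show ?thesis .
  qed
  have mat: "matrix_reachable (length L, Bs, mat_of L (only_first xs)) \<longleftrightarrow>
      (\<exists>y. computes g xs y)" if xs: "length xs = k" for xs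
  proof -
    have "matrix_reachable (length L, Bs, mat_of L (only_first xs)) \<longleftrightarrow>
        (\<exists>w. w \<noteq> [] \<and> set w \<subseteq> {..<2} \<and>
          (\<forall>z\<in>J. \<forall>z'\<in>J. vrun J gen (uvec z) w z' = only_first xs z z'))"
      using foldr_eq_mat_of_iff[of L Bs gen, OF L(1) Bs]
      by (auto simp: len(1) L(2))
    also have "\<dots> \<longleftrightarrow> (\<exists>y. computes g xs y)"
    proof
      assume "\<exists>w. w \<noteq> [] \<and> set w \<subseteq> {..<2} \<and>
          (\<forall>z\<in>J. \<forall>z'\<in>J. vrun J gen (uvec z) w z' = only_first xs z z')"
      moreover have "?start \<in> J" using r0 by (simp add: J_def)
      ultimately obtain w where "\<forall>z'\<in>J. vrun J gen (uvec ?start) w z' = only_first xs ?start z'"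
        by blast
      then show "\<exists>y. computes g xs y" by (intro sound[OF xs, of w]) (simp add: only_first_def)
    next
      assume "\<exists>y. computes g xs y"
      from complete[OF xs this] obtain w where w: "w \<noteq> []" "set w \<subseteq> {..<2}"
        "vrun J gen (uvec ?start) w = target xs"
        "\<forall>z\<in>J. z \<noteq> ?start \<longrightarrow> vrun J gen (uvec z) w = (\<lambda>_. 0)" by blast
      then show "\<exists>w. w \<noteq> [] \<and> set w \<subseteq> {..<2} \<and>
          (\<forall>z\<in>J. \<forall>z'\<in>J. vrun J gen (uvec z) w z' = only_first xs z z')"
        by (intro exI[of _ w]) (simp add: only_first_def)
    qed
    finally show ?thesis .
  qed
  have code: "mat_code (mat_of L (only_first xs)) = list_encode (row_code xs tail # zs)"
    if xs: "length xs = k" for xs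
  proof -
    have "z \<noteq> ?start" if "z \<in> set (tl L)" for z using that L(1) L0 by (metis distinct.simps(2))
    then have "map (\<lambda>x. list_encode (map (\<lambda>y. zmax_code (only_first xs x y)) L)) (tl L) = zs"
      by (auto simp: zs_def only_first_def zero_zmax_def)
    moreover have "list_encode (map (\<lambda>y. zmax_code (only_first xs ?start y)) L) = row_code xs tail"
      using target_code[OF xs] by (simp add: only_first_def)
    ultimately show ?thesis
      unfolding mat_code_mat_of by (subst (2) L0) (simp del: list_encode.simps)
  qed
  have "\<exists>M. mat_code M = list_encode (row_code xs tail # zs) \<and>
      (length L, Bs, M) \<in> matrix_instances 2 \<and>
      (matrix_reachable (length L, Bs, M) \<longleftrightarrow> (\<exists>y. computes g xs y))" if "length xs = k" for xs
    using that len code mat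
    by (intro exI[of _ "mat_of L (only_first xs)"] conjI)
      (simp_all add: matrix_instances_def del: matrix_reachable.simps list_encode.simps)
  then show "\<exists>n As tail zs. \<forall>xs. length xs = k \<longrightarrow> (\<exists>M.
      mat_code M = list_encode (row_code xs tail # zs) \<and> (n, As, M) \<in> matrix_instances 2 \<and>
      (matrix_reachable (n, As, M) \<longleftrightarrow> (\<exists>y. computes g xs y)))"
    by - ((rule exI)+, blast)
  have "\<exists>\<eta>. mat_code \<eta> = list_encode [row_code xs tail] \<and>
      (length L, Bs, row_of L (uvec ?start), \<eta>) \<in> vector_instances 2 \<and>
      (vector_reachable (length L, Bs, row_of L (uvec ?start), \<eta>) \<longleftrightarrow> (\<exists>y. computes g xs y))"
    if xs: "length xs = k" for xs
    using xs len target_code vec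
    by (intro exI[of _ "row_of L (target xs)"] conjI)
      (simp_all add: vector_instances_def mat_code_row_of del: vector_reachable.simps list_encode.simps One_nat_def)
  then show "\<exists>n As \<alpha> tail. \<forall>xs. length xs = k \<longrightarrow> (\<exists>\<eta>.
      mat_code \<eta> = list_encode [row_code xs tail] \<and> (n, As, \<alpha>, \<eta>) \<in> vector_instances 2 \<and>
      (vector_reachable (n, As, \<alpha>, \<eta>) \<longleftrightarrow> (\<exists>y. computes g xs y)))"
    by - ((rule exI)+, blast)
qed

text \<open>In both parts \<open>xs\<close> lists the codes of those parts of the instance family that \<open>F\<close> needs to rebuild the
code of the member with arguments \<open>xs\<close>.\<close>

theorem theorem3:
  "\<not> decidable matrix_code (matrix_instances 2) matrix_reachable \<and>
   \<not> decidable vector_code (vector_instances 2) vector_reachable"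
proof
  show "\<not> decidable matrix_code (matrix_instances 2) matrix_reachable"
  proof
    assume "decidable matrix_code (matrix_instances 2) matrix_reachable"
    then obtain D where D: "\<And>x. x \<in> matrix_instances 2 \<Longrightarrow>
        computes D [matrix_code x] (if matrix_reachable x then 1 else 0)"
      unfolding decidable_def by blast
    define F where "F = foldr cons_rec [Proj 0, Proj 1, cons_rec (row_rec 4 2) (Proj 3)] Zero"
    obtain n As tail zs where inst: "\<forall>xs. length xs = 4 \<longrightarrow> (\<exists>M.
        mat_code M = list_encode (row_code xs tail # zs) \<and> (n, As, M) \<in> matrix_instances 2 \<and>
        (matrix_reachable (n, As, M) \<longleftrightarrow> (\<exists>y. computes (diag_rec D F) xs y)))"
      using matrix_instances_for[of 4 "diag_rec D F"] by (elim exE) (rule that)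
    define xs where "xs = [n, list_encode (map mat_code As), list_encode tail, list_encode zs]"
    have len: "length xs = 4" by (simp add: xs_def)
    from inst len obtain M where M: "mat_code M = list_encode (row_code xs tail # zs)"
      "(n, As, M) \<in> matrix_instances 2"
      "matrix_reachable (n, As, M) \<longleftrightarrow> (\<exists>y. computes (diag_rec D F) xs y)"
      by blast
    have "computes (cons_rec (row_rec 4 2) (Proj 3)) xs (mat_code M)"
      unfolding M(1) by (intro computes_cons computes_row) (simp_all add: xs_def computes_simps)
    then have "computes F xs (matrix_code (n, As, M))"
      unfolding F_def matrix_code.simps
      by (intro computes_list) (simp add: xs_def computes_simps)
    from diag_rec_halts_iff[OF len this D[OF M(2)]] M(3) show False by blast
  qed
  show "\<not> decidable vector_code (vector_instances 2) vector_reachable"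
  proof
    assume "decidable vector_code (vector_instances 2) vector_reachable"
    then obtain D where D: "\<And>x. x \<in> vector_instances 2 \<Longrightarrow>
        computes D [vector_code x] (if vector_reachable x then 1 else 0)"
      unfolding decidable_def by blast
    define F where
      "F = foldr cons_rec [Proj 0, Proj 1, Proj 2, foldr cons_rec [row_rec 4 3] Zero] Zero"
    obtain n As \<alpha> tail where inst: "\<forall>xs. length xs = 4 \<longrightarrow> (\<exists>\<eta>.
        mat_code \<eta> = list_encode [row_code xs tail] \<and> (n, As, \<alpha>, \<eta>) \<in> vector_instances 2 \<and>
        (vector_reachable (n, As, \<alpha>, \<eta>) \<longleftrightarrow> (\<exists>y. computes (diag_rec D F) xs y)))"
      using vector_instances_for[of 4 "diag_rec D F"] by (elim exE) (rule that)
    define xs where "xs = [n, list_encode (map mat_code As), mat_code \<alpha>, list_encode tail]"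
    have len: "length xs = 4" by (simp add: xs_def)
    from inst len obtain \<eta> where \<eta>: "mat_code \<eta> = list_encode [row_code xs tail]"
      "(n, As, \<alpha>, \<eta>) \<in> vector_instances 2"
      "vector_reachable (n, As, \<alpha>, \<eta>) \<longleftrightarrow> (\<exists>y. computes (diag_rec D F) xs y)"
      by blast
    have "computes (foldr cons_rec [row_rec 4 3] Zero) xs (mat_code \<eta>)"
      unfolding \<eta>(1)
      by (intro computes_list list_all2_Cons[THEN iffD2] conjI computes_row) (simp_all add: xs_def)
    then have "computes F xs (vector_code (n, As, \<alpha>, \<eta>))"
      unfolding F_def vector_code.simps
      by (intro computes_list) (simp add: xs_def computes_simps)
    from diag_rec_halts_iff[OF len this D[OF \<eta>(2)]] \<eta>(3) show False by blast
  qed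
qed

end
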